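(* Let $g\ge 0$ be a fixed integer. Let $\{G_n\}$ be a positive linear recurrence sequence $G_n=c_1G_{n-1}+\cdots+c_LG_{n-L}$ with the additional constraint that all the coefficients $c_1,\dots,c_L$ are positive. Suppose there exists $n_0\in\mathbb{N}$ such that the random variable $K_{g,n}$ is non-trivial (i.e., is not the constant $0$) for all $n\ge n_0$. Let $\mu_{g,n}=\mathbb{E}[K_{g,n}]$. Then there exist constants $C_{\mu,g}>0$, $d_{\mu,g}\in\mathbb{R}$ and $\gamma_{\mu,g}\in(0,1)$, depending only on $g$, $L$ and the $c_i$'s, such that \[\mu_{g,n}=C_{\mu,g}\,n+d_{\mu,g}+O(\gamma_{\mu,g}^n)\quad (n\to\infty).\]
   Context: A positive linear recurrence sequence (PLRS) is a sequence $\{G_n\}_{n\ge1}$ satisfying $G_n=c_1G_{n-1}+\cdots+c_LG_{n-L}$ (for $n>L$), where the $c_i$ are non-negative integers with $L\ge1$, $c_1\ge1$, $c_L\ge1$, and with initial conditions $G_1=1$ and $G_n=c_1G_{n-1}+c_2G_{n-2}+\cdots+c_{n-1}G_1+1$ for $1\le n\le L$. A decomposition $M=\sum_{i=1}^N a_iG_{N+1-i}$ with $a_1>0$ and $a_i\ge0$ is legal if either (1) $N<L$ and $a_i=c_i$ for $1\le i\le N$, or (2) there is $s\in\{1,\dots,L\}$ with $a_1=c_1,\dots,a_{s-1}=c_{s-1}$, $a_s<c_s$, $a_{s+1}=\cdots=a_{s+\ell}=0$ for some $\ell\ge0$, and the sequence $(b_i)_{i=1}^{N-s-\ell}$ with $b_i=a_{s+\ell+i}$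 is either legal or empty. Every positive integer $M$ has a unique legal decomposition (generalized Zeckendorf theorem). Writing this decomposition as $M=G_{i_1}+G_{i_2}+\cdots+G_{i_k}$ with $i_1\ge i_2\ge\cdots\ge i_k$ (each $G_j$ repeated according to its coefficient), the gaps of $M$ are $i_1-i_2,\,i_2-i_3,\dots,i_{k-1}-i_k$, and $k_g(M)$ denotes the number of gaps equal to $g$. $K_{g,n}$ is the random variable $k_g(M)$ for $M$ chosen uniformly at random from the integers in $[G_n,G_{n+1})$. *)

theory Defs
  imports "HOL-Probability.Probability" "HOL-Library.Landau_Symbols"
begin

text \<open>The coefficients \<open>c\<^sub>1, \<dots>, c\<^sub>L\<close> form a list \<open>c\<close>, so \<open>L = length c\<close> and
  \<open>c\<^sub>i = c ! (i - 1)\<close>. A sequence \<open>(G\<^sub>n)\<close> indexed from 1 is a function on \<open>nat\<close> whose value at 0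
  is unconstrained.\<close>

definition plrs :: "nat list \<Rightarrow> (nat \<Rightarrow> nat) \<Rightarrow> bool" where
  "plrs c G \<longleftrightarrow>
     length c \<ge> 1 \<and> hd c \<ge> 1 \<and> last c \<ge> 1 \<and>
     G 1 = 1 \<and>
     (\<forall>n. 1 \<le> n \<and> n \<le> length c \<longrightarrow> G n = (\<Sum>i\<in>{1..<n}. c ! (i - 1) * G (n - i)) + 1) \<and>
     (\<forall>n>length c. G n = (\<Sum>i\<in>{1..length c}. c ! (i - 1) * G (n - i)))"

text \<open>Coefficient sequences \<open>a\<^sub>1, \<dots>, a\<^sub>N\<close> are lists, leading coefficient first.
  In the second rule \<open>j = s - 1\<close> and \<open>x = a\<^sub>s\<close>.\<close>

inductive legal :: "nat list \<Rightarrow> nat list \<Rightarrow> bool" for c :: "nat list" where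
  partial: "a \<noteq> [] \<Longrightarrow> hd a > 0 \<Longrightarrow> length a < length c \<Longrightarrow> a = take (length a) c \<Longrightarrow> legal c a"
| block: "j < length c \<Longrightarrow> x < c ! j \<Longrightarrow> a = take j c @ [x] @ replicate l 0 @ b \<Longrightarrow> hd a > 0 \<Longrightarrow>
    b = [] \<or> legal c b \<Longrightarrow> legal c a"

definition decomp_value :: "(nat \<Rightarrow> nat) \<Rightarrow> nat list \<Rightarrow> nat" where
  "decomp_value G a = (\<Sum>i\<in>{1..length a}. a ! (i - 1) * G (length a + 1 - i))"

text \<open>Existence and uniqueness are the generalized Zeckendorf theorem. They fail for \<open>c = [1]\<close>,
  where \<open>G\<close> is constant and the intervals \<open>[G\<^sub>n, G\<^sub>n\<^sub>+\<^sub>1)\<close> are empty.\<close>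

definition legal_decomp :: "nat list \<Rightarrow> (nat \<Rightarrow> nat) \<Rightarrow> nat \<Rightarrow> nat list" where
  "legal_decomp c G M = (THE a. legal c a \<and> decomp_value G a = M)"

text \<open>The indices \<open>i\<^sub>1 \<ge> \<dots> \<ge> i\<^sub>k\<close>, each repeated according to its coefficient.\<close>

definition summand_indices :: "nat list \<Rightarrow> nat list" where
  "summand_indices a = concat (map (\<lambda>i. replicate (a ! (i - 1)) (length a + 1 - i)) [1..<length a + 1])"

text \<open>For a non-increasing list the truncated subtraction is exact.\<close>

definition gaps :: "nat list \<Rightarrow> nat list" where
  "gaps js = map2 (-) js (tl js)"

definition num_gaps :: "nat list \<Rightarrow> (nat \<Rightarrow> nat) \<Rightarrow> nat \<Rightarrow> nat \<Rightarrow> nat" where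
  "num_gaps c G g M = count_list (gaps (summand_indices (legal_decomp c G M))) g"

definition mean_gaps :: "nat list \<Rightarrow> (nat \<Rightarrow> nat) \<Rightarrow> nat \<Rightarrow> nat \<Rightarrow> real" where
  "mean_gaps c G g n =
     measure_pmf.expectation (pmf_of_set {G n..<G (n + 1)}) (\<lambda>M. real (num_gaps c G g M))"

text \<open>\<open>K\<^sub>g\<^sub>,\<^sub>n\<close> is not the constant 0 on its sample space.\<close>

definition nontrivial_gaps :: "nat list \<Rightarrow> (nat \<Rightarrow> nat) \<Rightarrow> nat \<Rightarrow> nat \<Rightarrow> bool" where
  "nontrivial_gaps c G g n \<longleftrightarrow> (\<exists>M\<in>{G n..<G (n + 1)}. num_gaps c G g M \<noteq> 0)"

end

theory Submission imports Defs
begin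

text \<open>Read with leading zeros allowed, legal coefficient sequences of length \<open>n\<close> are the words
  accepted by an automaton whose state \<open>j < L\<close> records how many coefficients of \<open>c\<close> have just been
  matched; their number is \<open>G\<^sub>n\<^sub>+\<^sub>1\<close>. Splitting off one digit at a time, the number of accepted words
  and the total number of gaps over all of them both satisfy the recurrence of \<open>G\<close>, the latter with
  an inhomogeneous term counting the gaps that begin in the first block. After multiplication by
  \<open>\<rho>\<^sup>n\<close>, where \<open>\<Sum> c\<^sub>i \<rho>\<^sup>i = 1\<close>, they become renewal equations with strictly positive weights, whose
  solutions converge geometrically up to a linear term. The leading zeros drop out in the
  differences of consecutive values, and the mean is a quotient of two such differences.\<close>

section \<open>Geometric convergence and renewal equations\<close>

text \<open>Asking for the bound at every \<open>n\<close> instead of eventually costs nothing,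
  since \<open>K\<close> can absorb finitely many terms. The rate is existential so that two
  sequences may be combined at the larger of their rates.\<close>

definition geom_conv :: "(nat \<Rightarrow> real) \<Rightarrow> real \<Rightarrow> bool" where
  "geom_conv f l \<longleftrightarrow> (\<exists>K \<gamma>. 0 < \<gamma> \<and> \<gamma> < 1 \<and> (\<forall>n. \<bar>f n - l\<bar> \<le> K * \<gamma> ^ n))"

lemma geom_convI: "0 < \<gamma> \<Longrightarrow> \<gamma> < 1 \<Longrightarrow> (\<And>n. \<bar>f n - l\<bar> \<le> K * \<gamma> ^ n) \<Longrightarrow> geom_conv f l"
  unfolding geom_conv_def by blast

lemma geom_convE:
  assumes "geom_conv f l"
  obtains K \<gamma> where "0 \<le> K" "0 < \<gamma>" "\<gamma> < 1" "\<And>n. \<bar>f n - l\<bar> \<le> K * \<gamma> ^ n"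
proof -
  obtain K \<gamma> where *: "0 < \<gamma>" "\<gamma> < 1" "\<And>n. \<bar>f n - l\<bar> \<le> K * \<gamma> ^ n"
    using assms unfolding geom_conv_def by blast
  have "0 \<le> K" using *(3)[of 0] by simp
  with * show ?thesis by (intro that)
qed

lemma geom_conv_const: "geom_conv (\<lambda>n. k) k"
  by (rule geom_convI[of "1/2" _ _ 0]) auto

lemma geom_conv_add:
  assumes "geom_conv f k" "geom_conv h l"
  shows "geom_conv (\<lambda>n. f n + h n) (k + l)"
proof -
  obtain K1 \<gamma>1 where 1: "0 \<le> K1" "0 < \<gamma>1" "\<gamma>1 < 1" "\<And>n. \<bar>f n - k\<bar> \<le> K1 * \<gamma>1 ^ n"
    using geom_convE[OF assms(1)] by blast
  obtain K2 \<gamma>2 where 2: "0 \<le> K2" "0 < \<gamma>2" "\<gamma>2 < 1" "\<And>n. \<bar>h n - l\<bar> \<le> K2 * \<gamma>2 ^ n"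
    using geom_convE[OF assms(2)] by blast
  show ?thesis
  proof (rule geom_convI[of "max \<gamma>1 \<gamma>2" _ _ "K1 + K2"])
    fix n
    have "\<bar>f n + h n - (k + l)\<bar> \<le> K1 * \<gamma>1 ^ n + K2 * \<gamma>2 ^ n"
      using 1(4)[of n] 2(4)[of n] by linarith
    also have "\<dots> \<le> K1 * max \<gamma>1 \<gamma>2 ^ n + K2 * max \<gamma>1 \<gamma>2 ^ n"
      using 1 2 by (intro add_mono mult_left_mono power_mono) auto
    finally show "\<bar>f n + h n - (k + l)\<bar> \<le> (K1 + K2) * max \<gamma>1 \<gamma>2 ^ n"
      by (simp add: algebra_simps)
  qed (use 1 2 in auto)
qed

lemma geom_conv_cmult:
  assumes "geom_conv f l"
  shows "geom_conv (\<lambda>n. k * f n) (k * l)"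
proof -
  obtain K \<gamma> where 1: "0 \<le> K" "0 < \<gamma>" "\<gamma> < 1" "\<And>n. \<bar>f n - l\<bar> \<le> K * \<gamma> ^ n"
    using geom_convE[OF assms(1)] by blast
  show ?thesis
  proof (rule geom_convI[of \<gamma> _ _ "\<bar>k\<bar> * K"])
    fix n
    have "\<bar>k * f n - k * l\<bar> = \<bar>k\<bar> * \<bar>f n - l\<bar>"
      by (simp add: abs_mult[symmetric] right_diff_distrib)
    then show "\<bar>k * f n - k * l\<bar> \<le> \<bar>k\<bar> * K * \<gamma> ^ n"
      using mult_left_mono[OF 1(4)[of n], of "\<bar>k\<bar>"] by (simp add: mult.assoc)
  qed (use 1 in auto)
qed

lemma geom_conv_diff:
  assumes "geom_conv f k" "geom_conv h l"
  shows "geom_conv (\<lambda>n. f n - h n) (k - l)"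
  using geom_conv_add[OF assms(1) geom_conv_cmult[OF assms(2), of "-1"]] by simp

lemma geom_conv_shift:
  assumes "geom_conv f l"
  shows "geom_conv (\<lambda>n. f (n + k)) l"
proof -
  obtain K \<gamma> where 1: "0 \<le> K" "0 < \<gamma>" "\<gamma> < 1" "\<And>n. \<bar>f n - l\<bar> \<le> K * \<gamma> ^ n"
    using geom_convE[OF assms(1)] by blast
  show ?thesis
    by (rule geom_convI[of \<gamma> _ _ "K * \<gamma> ^ k"])
      (use 1 1(4)[of "_ + k"] in \<open>auto simp: power_add ac_simps\<close>)
qed

lemma geom_conv_unshift:
  assumes "geom_conv (\<lambda>n. f (Suc n)) l"
  shows "geom_conv f l"
proof -
  obtain K \<gamma> where 1: "0 \<le> K" "0 < \<gamma>" "\<gamma> < 1" "\<And>n. \<bar>f (Suc n) - l\<bar> \<le> K * \<gamma> ^ n"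
    using geom_convE[OF assms(1)] by blast
  show ?thesis
  proof (rule geom_convI[of \<gamma> _ _ "max \<bar>f 0 - l\<bar> (K / \<gamma>)"])
    fix n show "\<bar>f n - l\<bar> \<le> max \<bar>f 0 - l\<bar> (K / \<gamma>) * \<gamma> ^ n"
    proof (cases n)
      case (Suc m)
      have "\<bar>f n - l\<bar> \<le> K / \<gamma> * \<gamma> ^ n" using 1(4)[of m] 1 Suc by simp
      also have "\<dots> \<le> max \<bar>f 0 - l\<bar> (K / \<gamma>) * \<gamma> ^ n"
        using 1 by (intro mult_right_mono) auto
      finally show ?thesis .
    qed auto
  qed (use 1 in auto)
qed

lemma geom_conv_tendsto:
  assumes "geom_conv f l"
  shows "f \<longlonglongrightarrow> l"
proof -
  obtain K \<gamma> where 1: "0 \<le> K" "0 < \<gamma>" "\<gamma> < 1" "\<And>n. \<bar>f n - l\<bar> \<le> K * \<gamma> ^ n"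
    using geom_convE[OF assms(1)] by blast
  have "(\<lambda>n. K * \<gamma> ^ n) \<longlonglongrightarrow> K * 0"
    using 1 by (intro tendsto_mult tendsto_const LIMSEQ_power_zero) auto
  then have lim: "(\<lambda>n. K * \<gamma> ^ n) \<longlonglongrightarrow> 0" by (simp only: mult_zero_right)
  have "(\<lambda>n. f n - l) \<longlonglongrightarrow> 0"
    by (rule Lim_null_comparison[OF always_eventually lim]) (use 1(4) in simp)
  then show ?thesis by (rule LIM_zero_cancel)
qed

section \<open>Increments, summation by parts and renewal equations\<close>

lemma geom_convI_increments:
  assumes "0 < \<gamma>" "\<gamma> < 1" "\<And>n. \<bar>y (Suc n) - y n\<bar> \<le> K * \<gamma> ^ n"
  shows "\<exists>d. geom_conv y d"
proof -
  let ?D = "\<lambda>n. y (Suc n) - y n"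
  have sK: "summable (\<lambda>n. K * \<gamma> ^ n)" using assms by (intro summable_mult summable_geometric) auto
  have sD: "summable ?D" by (rule summable_comparison_test[OF _ sK]) (use assms in auto)
  \<comment> \<open>The distance of \<open>y n\<close> from the limit is the tail of the series of
    increments, hence dominated by the tail of a geometric series.\<close>
  have tail: "\<bar>suminf ?D + y 0 - y n\<bar> \<le> K / (1 - \<gamma>) * \<gamma> ^ n" for n
  proof -
    have "(\<Sum>i<n. ?D i) = y n - y 0" by (rule sum_lessThan_telescope)
    then have eq: "suminf ?D + y 0 - y n = (\<Sum>i. ?D (i + n))"
      using suminf_split_initial_segment[OF sD, of n] by simp
    have "norm (\<Sum>i. ?D (i + n)) \<le> (\<Sum>i. K * \<gamma> ^ n * \<gamma> ^ i)"
    proof (rule norm_suminf_le)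
      show "norm (?D (i + n)) \<le> K * \<gamma> ^ n * \<gamma> ^ i" for i
        using assms(3)[of "i + n"] by (simp add: power_add ac_simps)
    qed (use assms in \<open>intro summable_mult summable_geometric, auto\<close>)
    also have "\<dots> = K * \<gamma> ^ n * (1 / (1 - \<gamma>))"
      using assms by (simp add: suminf_mult suminf_geometric)
    finally show ?thesis unfolding eq by (simp add: ac_simps)
  qed
  have "geom_conv y (suminf ?D + y 0)"
    by (rule geom_convI[OF assms(1,2)]) (subst abs_minus_commute, rule tail)
  then show ?thesis ..
qed

text \<open>When the \<open>a k\<close> add up to 1, the right side is \<open>y n\<close> minus a
  weighted average of the preceding values, the defect in a renewal equation, while the left side
  involves increments only. It is used both to pass to increments and to pass back.\<close>

lemma sum_by_parts_partial_sums:
  fixes a y :: "nat \<Rightarrow> real"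
  shows "(\<Sum>i<n. (\<Sum>k\<le>i. a k) * (y (Suc i) - y i)) = (\<Sum>k<n. a k) * y n - (\<Sum>i<n. a i * y i)"
  by (induction n) (auto simp: lessThan_Suc_atMost[symmetric] algebra_simps)

text \<open>A weighted average of the last \<open>L\<close> values cannot exceed the largest bound
  on them, so only the errors can push the bound up, and these have a finite total.\<close>

lemma bounded_weighted_recurrence:
  fixes F :: "nat \<Rightarrow> real"
  assumes rec: "\<And>n. F (n + L) = (\<Sum>i<L. r i * F (n + i)) + e n"
    and r: "\<And>i. i < L \<Longrightarrow> 0 \<le> r i" "(\<Sum>i<L. r i) = 1"
    and e: "\<And>n. \<bar>e n\<bar> \<le> K * \<gamma> ^ n" "0 \<le> \<gamma>" "\<gamma> < 1"
  shows "\<exists>B. \<forall>n. \<bar>F n\<bar> \<le> B"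
proof -
  define A where "A = (\<Sum>i<L. \<bar>F i\<bar>)"
  have K: "0 \<le> K" using e(1)[of 0] by simp
  have L: "0 < L" using r(2) by (cases L) auto
  \<comment> \<open>The errors that have entered by index \<open>n\<close> are those at 0 up to
    \<open>n - L\<close>. For \<open>n < L\<close> truncated subtraction makes the sum empty and
    leaves the bound \<open>A\<close> on the initial values.\<close>
  define B where "B n = A + K * (\<Sum>k<n+1-L. \<gamma> ^ k)" for n
  have mono: "B m \<le> B n" if "m \<le> n" for m n
    unfolding B_def using that e K
    by (intro add_left_mono mult_left_mono sum_mono2) auto
  have bound: "\<bar>F n\<bar> \<le> B n" for n
  proof (induction n rule: less_induct)
    case (less n)
    show ?case
    proof (cases "n < L")
      case True
      then have "\<bar>F n\<bar> \<le> A" unfolding A_def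
        by (intro member_le_sum[of n "{..<L}" "\<lambda>i. \<bar>F i\<bar>"]) auto
      then show ?thesis using True by (simp add: B_def)
    next
      case False
      then obtain m where m: "n = m + L" by (metis add.commute le_Suc_ex not_less)
      have "\<bar>F n\<bar> \<le> \<bar>\<Sum>i<L. r i * F (m + i)\<bar> + \<bar>e m\<bar>" unfolding m rec by linarith
      also have "\<bar>\<Sum>i<L. r i * F (m + i)\<bar> \<le> (\<Sum>i<L. r i * B (m + L - 1))"
      proof (rule order_trans[OF sum_abs sum_mono])
        fix i assume i: "i \<in> {..<L}"
        have "\<bar>F (m + i)\<bar> \<le> B (m + i)" using i m by (intro less) auto
        also have "\<dots> \<le> B (m + L - 1)" using i by (intro mono) auto
        finally show "\<bar>r i * F (m + i)\<bar> \<le> r i * B (m + L - 1)"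
          using r i by (simp add: abs_mult mult_left_mono)
      qed
      also have "(\<Sum>i<L. r i * B (m + L - 1)) = B (m + L - 1)"
        by (simp add: sum_distrib_right[symmetric] r)
      finally have "\<bar>F n\<bar> \<le> B (m + L - 1) + K * \<gamma> ^ m" using e(1)[of m] by linarith
      also have "\<dots> = B n" using L by (simp add: B_def m algebra_simps)
      finally show ?thesis .
    qed
  qed
  have "(\<Sum>k<n. \<gamma> ^ k) \<le> 1 / (1 - \<gamma>)" for n
    using e sum_le_suminf[OF summable_geometric[of \<gamma>], of "{..<n}"]
    by (simp add: suminf_geometric)
  then have "B n \<le> A + K * (1 / (1 - \<gamma>))" for n
    unfolding B_def using K by (intro add_left_mono mult_left_mono) auto
  then show ?thesis using bound order_trans by blast
qed

text \<open>Summation by parts turns the recurrence for \<open>y\<close> into one for its increments whose coefficients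
  are the partial sums of \<open>a\<close>. These increase strictly, so they stay monotone after the increments
  are divided by \<open>\<theta> ^ n\<close> for some \<open>\<theta> < 1\<close> (as in the Enestroem-Kakeya theorem); a second summation
  by parts then exhibits the rescaled increments as perturbed weighted averages of earlier ones.\<close>

lemma renewal_geom_conv:
  fixes y :: "nat \<Rightarrow> real"
  assumes rec: "\<And>n. y (n + L) = (\<Sum>i<L. a i * y (n + i)) + e n"
    and a: "\<And>i. i < L \<Longrightarrow> 0 < a i" "(\<Sum>i<L. a i) = 1"
    and e: "geom_conv e 0"
  shows "\<exists>d. geom_conv y d"
proof -
  obtain K \<gamma> where K: "0 \<le> K" "0 < \<gamma>" "\<gamma> < 1" "\<And>n. \<bar>e n - 0\<bar> \<le> K * \<gamma> ^ n"
    using geom_convE[OF e] by blast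
  define b where "b i = (\<Sum>k\<le>i. a k)" for i
  have b0: "0 < b i" if "i < L" for i
    unfolding b_def using that a by (intro sum_pos) auto
  obtain M where M: "L = Suc M" using a(2) by (cases L) auto
  have bM: "b M = 1" using a(2) by (simp add: b_def M lessThan_Suc_atMost)
  \<comment> \<open>The ratios of consecutive partial sums are below 1 because every
    \<open>a i\<close> is positive. The midpoint \<open>\<theta>\<close> of \<open>q\<close> and 1
    still dominates them, and it exceeds \<open>\<gamma>\<close> strictly, so the errors keep
    decaying after division by \<open>\<theta> ^ n\<close>.\<close>
  define q where "q = Max (insert \<gamma> ((\<lambda>i. b i / b (Suc i)) ` {..<M}))"
  define \<theta> where "\<theta> = (1 + q) / 2"
  have "b i / b (Suc i) < 1" if "i < M" for i
    using b0[of "Suc i"] a(1)[of "Suc i"] that M by (simp add: b_def)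
  then have q1: "q < 1" unfolding q_def using K(3) by (subst Max_less_iff) auto
  have q2: "\<gamma> \<le> q" unfolding q_def by auto
  have q3: "b i / b (Suc i) \<le> q" if "i < M" for i
    unfolding q_def using that by (intro Max_ge) auto
  have \<theta>: "\<theta> < 1" "\<gamma> < \<theta>" "0 < \<theta>" "q \<le> \<theta>" using q1 q2 K unfolding \<theta>_def by auto
  have b\<theta>: "b i \<le> \<theta> * b (Suc i)" if "i < M" for i
  proof -
    have "0 < b (Suc i)" using b0 that M by simp
    then have "b i \<le> q * b (Suc i)" using q3[OF that] by (simp add: pos_divide_le_eq)
    also have "\<dots> \<le> \<theta> * b (Suc i)" using \<theta>(4) \<open>0 < b (Suc i)\<close> by (intro mult_right_mono) auto
    finally show ?thesis .
  qed
  define D where "D n = y (Suc n) - y n" for n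
  define F where "F n = D n / \<theta> ^ n" for n
  have eqD: "(\<Sum>i<L. b i * D (n + i)) = e n" for n
    using sum_by_parts_partial_sums[of a "\<lambda>i. y (n + i)" L] rec[of n] a(2)
    by (simp add: b_def D_def)
  define b' where "b' i = b i * \<theta> ^ i / \<theta> ^ M" for i
  \<comment> \<open>\<open>r\<close> is chosen to have the partial sums \<open>b'\<close>. The
    factor \<open>\<theta> ^ M\<close> in \<open>b'\<close> normalises their last value to 1, and
    \<open>b\<theta>\<close> makes \<open>r\<close> nonnegative.\<close>
  define r where "r i = (case i of 0 \<Rightarrow> b' 0 | Suc j \<Rightarrow> b' (Suc j) - b' j)" for i
  have sum_r: "(\<Sum>k\<le>i. r k) = b' i" for i
    by (induction i) (auto simp: r_def)
  have sum_rL: "(\<Sum>k<L. r k) = 1"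
    unfolding M lessThan_Suc_atMost sum_r using bM \<theta> by (simp add: b'_def)
  have r0: "0 \<le> r i" if "i < L" for i
  proof (cases i)
    case 0 then show ?thesis using b0[of 0] that \<theta> by (simp add: r_def b'_def)
  next
    case (Suc j)
    then have "b j * \<theta> ^ j \<le> \<theta> * b (Suc j) * \<theta> ^ j" using b\<theta>[of j] that M \<theta>
      by (intro mult_right_mono) auto
    then show ?thesis using Suc \<theta> by (simp add: r_def b'_def field_simps)
  qed
  define e' where "e' n = e n / (\<theta> ^ n * \<theta> ^ M)" for n
  have eqF: "(\<Sum>i<L. b' i * F (n + i)) = e' n" for n
  proof -
    have "b' i * F (n + i) = b i * D (n + i) / (\<theta> ^ n * \<theta> ^ M)" for i
      using \<theta> by (simp add: b'_def F_def power_add field_simps)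
    then show ?thesis using eqD[of n] by (simp add: e'_def sum_divide_distrib[symmetric])
  qed
  \<comment> \<open>Subtracting \<open>eqF\<close> at \<open>n\<close> from \<open>eqF\<close> at
    \<open>n + 1\<close> leaves increments of \<open>F\<close> weighted by the partial sums of
    \<open>r\<close>; summation by parts then isolates \<open>F (n + L)\<close>.\<close>
  have recF: "F (n + L) = (\<Sum>i<L. r i * F (n + i)) + (e' (Suc n) - e' n)" for n
  proof -
    have "e' (Suc n) - e' n = (\<Sum>i<L. b' i * (F (n + Suc i) - F (n + i)))"
      using eqF[of n] eqF[of "Suc n"] by (simp add: right_diff_distrib sum_subtractf)
    then show ?thesis
      using sum_by_parts_partial_sums[of r "\<lambda>i. F (n + i)" L] sum_rL by (simp add: sum_r)
  qed
  have e'b: "\<bar>e' n\<bar> \<le> K / \<theta> ^ M * (\<gamma> / \<theta>) ^ n" for n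
  proof -
    have "\<bar>e' n\<bar> = \<bar>e n\<bar> / (\<theta> ^ n * \<theta> ^ M)" using \<theta> by (simp add: e'_def abs_mult)
    also have "\<dots> \<le> K * \<gamma> ^ n / (\<theta> ^ n * \<theta> ^ M)" using K \<theta> by (intro divide_right_mono) auto
    finally show ?thesis by (simp add: power_divide ac_simps)
  qed
  have "\<exists>B. \<forall>n. \<bar>F n\<bar> \<le> B"
  proof (rule bounded_weighted_recurrence[OF recF])
    fix n
    have "\<bar>e' (Suc n) - e' n\<bar> \<le> K / \<theta> ^ M * (\<gamma> / \<theta>) ^ Suc n + K / \<theta> ^ M * (\<gamma> / \<theta>) ^ n"
      using e'b[of n] e'b[of "Suc n"] by linarith
    also have "\<dots> = K / \<theta> ^ M * (\<gamma> / \<theta> + 1) * (\<gamma> / \<theta>) ^ n"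
      by (simp only: power_Suc distrib_left distrib_right mult_1 mult_1_right mult.assoc)
    finally show "\<bar>e' (Suc n) - e' n\<bar> \<le> K / \<theta> ^ M * (\<gamma> / \<theta> + 1) * (\<gamma> / \<theta>) ^ n" .
  qed (use r0 sum_rL \<theta> K in auto)
  then obtain B where B: "\<And>n. \<bar>F n\<bar> \<le> B" by blast
  have "\<bar>y (Suc n) - y n\<bar> \<le> B * \<theta> ^ n" for n
    using B[of n] \<theta> by (simp add: F_def D_def abs_mult field_simps)
  from geom_convI_increments[OF \<theta>(3,1) this] show ?thesis .
qed

text \<open>Here \<open>\<kappa>\<close> is the mean lag of the recurrence, the value at
  \<open>n + i\<close> lying \<open>L - i\<close> steps back. The function \<open>C * n\<close>
  satisfies the recurrence with forcing \<open>C * \<kappa>\<close>, so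
  \<open>C = \<eta> / \<kappa>\<close> reduces the problem to forcing that tends to 0.\<close>

lemma renewal_linear_growth:
  fixes s :: "nat \<Rightarrow> real"
  assumes rec: "\<And>n. s (n + L) = (\<Sum>i<L. a i * s (n + i)) + e n"
    and a: "\<And>i. i < L \<Longrightarrow> 0 < a i" "(\<Sum>i<L. a i) = 1"
    and e: "geom_conv e \<eta>" and \<eta>: "0 < \<eta>"
  shows "\<exists>C d. 0 < C \<and> geom_conv (\<lambda>n. s n - C * real n) d"
proof -
  define \<kappa> where "\<kappa> = (\<Sum>i<L. a i * (real L - real i))"
  have L: "0 < L" using a(2) by (cases L) auto
  have \<kappa>: "0 < \<kappa>" unfolding \<kappa>_def using L a by (intro sum_pos) auto
  define C where "C = \<eta> / \<kappa>"
  have "\<exists>d. geom_conv (\<lambda>n. s n - C * real n) d"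
  proof (rule renewal_geom_conv[OF _ a])
    fix n
    have "(\<Sum>i<L. a i * (C * real (n + i))) = (\<Sum>i<L. a i * (C * real (n + L)) - C * (a i * (real L - real i)))"
      by (intro sum.cong) (auto simp: algebra_simps)
    also have "\<dots> = C * real (n + L) - C * \<kappa>"
      by (simp add: sum_subtractf \<kappa>_def sum_distrib_left[symmetric] sum_distrib_right[symmetric] a(2) del: of_nat_add)
    finally show "s (n + L) - C * real (n + L) = (\<Sum>i<L. a i * (s (n + i) - C * real (n + i))) + (e n - \<eta>)"
      using \<kappa> by (simp add: rec right_diff_distrib sum_subtractf C_def)
  qed (use geom_conv_diff[OF e geom_conv_const[of \<eta>]] in auto)
  moreover have "0 < C" using \<eta> \<kappa> by (simp add: C_def)
  ultimately show ?thesis by blast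
qed

section \<open>Quotients of linearly growing by convergent sequences\<close>

lemma linear_times_geometric_bounded:
  fixes \<gamma> \<theta> A B :: real
  assumes "0 < \<gamma>" "\<gamma> < \<theta>"
  shows "(\<lambda>n. (A * real n + B) * \<gamma> ^ n) \<in> O(\<lambda>n. \<theta> ^ n)"
proof (rule bigoI_tendsto)
  have "(\<lambda>n. A * (real n * (\<gamma> / \<theta>) ^ n) + B * (\<gamma> / \<theta>) ^ n) \<longlonglongrightarrow> A * 0 + B * 0"
    using assms by (intro tendsto_intros powser_times_n_limit_0 LIMSEQ_power_zero) auto
  then show "(\<lambda>n. (A * real n + B) * \<gamma> ^ n / \<theta> ^ n) \<longlonglongrightarrow> A * 0 + B * 0"
    by (simp add: power_divide algebra_simps add_divide_distrib)
qed (use assms in auto)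

text \<open>The quotient is compared with \<open>(A * n + B) / Z\<close>. The error of
  \<open>z\<close> gets multiplied by the linearly growing numerator, so the rate must be enlarged
  from \<open>\<gamma>\<close> to some \<open>\<theta>\<close> still below 1.\<close>

lemma geom_conv_quotient:
  assumes x: "geom_conv (\<lambda>n. x n - A * real n) B" and z: "geom_conv z Z"
    and A: "0 < A" and Z: "0 < Z"
  shows "\<exists>C d \<gamma>. 0 < C \<and> 0 < \<gamma> \<and> \<gamma> < 1 \<and> (\<lambda>n. x n / z n - (C * real n + d)) \<in> O(\<lambda>n. \<gamma> ^ n)"
proof -
  obtain K1 \<gamma>1 where 1: "0 \<le> K1" "0 < \<gamma>1" "\<gamma>1 < 1" "\<And>n. \<bar>x n - A * real n - B\<bar> \<le> K1 * \<gamma>1 ^ n"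
    using geom_convE[OF x] by blast
  obtain K2 \<gamma>2 where 2: "0 \<le> K2" "0 < \<gamma>2" "\<gamma>2 < 1" "\<And>n. \<bar>z n - Z\<bar> \<le> K2 * \<gamma>2 ^ n"
    using geom_convE[OF z] by blast
  define \<gamma> where "\<gamma> = max \<gamma>1 \<gamma>2"
  define \<theta> where "\<theta> = (1 + \<gamma>) / 2"
  have \<gamma>: "0 < \<gamma>" "\<gamma> < \<theta>" "\<theta> < 1" "0 < \<theta>" using 1 2 unfolding \<gamma>_def \<theta>_def by auto
  have x': "\<bar>x n - (A * real n + B)\<bar> \<le> K1 * \<gamma> ^ n" for n
  proof -
    have "K1 * \<gamma>1 ^ n \<le> K1 * \<gamma> ^ n" using 1 unfolding \<gamma>_def by (intro mult_left_mono power_mono) auto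
    with 1(4)[of n] show ?thesis by linarith
  qed
  have z': "\<bar>z n - Z\<bar> \<le> K2 * \<gamma> ^ n" for n
  proof -
    have "K2 * \<gamma>2 ^ n \<le> K2 * \<gamma> ^ n" using 2 unfolding \<gamma>_def by (intro mult_left_mono power_mono) auto
    with 2(4)[of n] show ?thesis by linarith
  qed
  have ev: "\<forall>\<^sub>F n in sequentially. Z / 2 < z n"
    using order_tendstoD(1)[OF geom_conv_tendsto[OF z], of "Z/2"] Z by simp
  let ?f = "\<lambda>n. (A * K2 * real n + (\<bar>B\<bar> * K2 + K1 * Z)) * \<gamma> ^ n"
  have "(\<lambda>n. x n / z n - (A / Z * real n + B / Z)) \<in> O(?f)"
  proof (rule bigoI[of _ "2 / Z\<^sup>2"])
    show "\<forall>\<^sub>F n in sequentially. norm (x n / z n - (A / Z * real n + B / Z)) \<le> 2 / Z\<^sup>2 * norm (?f n)"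
      using ev
    proof eventually_elim
      case (elim n)
      have zn: "0 < z n" using elim Z by linarith
      have f0: "0 \<le> ?f n" using A Z 1 2 \<gamma> by (intro mult_nonneg_nonneg add_nonneg_nonneg) auto
      have eq: "x n / z n - (A / Z * real n + B / Z)
          = ((x n - (A * real n + B)) * Z - (A * real n + B) * (z n - Z)) / (Z * z n)"
        using Z zn by (simp add: field_simps)
      have "\<bar>(x n - (A * real n + B)) * Z - (A * real n + B) * (z n - Z)\<bar>
          \<le> \<bar>x n - (A * real n + B)\<bar> * \<bar>Z\<bar> + \<bar>A * real n + B\<bar> * \<bar>z n - Z\<bar>"
        using abs_triangle_ineq4 by (simp add: abs_mult[symmetric])
      also have "\<dots> \<le> K1 * \<gamma> ^ n * Z + (A * real n + \<bar>B\<bar>) * (K2 * \<gamma> ^ n)"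
      proof (intro add_mono mult_mono x' z')
        have "\<bar>A * real n\<bar> = A * real n" using A by simp
        then show "\<bar>A * real n + B\<bar> \<le> A * real n + \<bar>B\<bar>" by linarith
      qed (use Z 1 \<gamma> A in auto)
      also have "\<dots> = ?f n" by (simp add: algebra_simps)
      finally have num: "\<bar>(x n - (A * real n + B)) * Z - (A * real n + B) * (z n - Z)\<bar> \<le> ?f n" .
      have den: "Z * (Z / 2) \<le> Z * z n" using Z elim by (intro mult_left_mono) auto
      have "norm (x n / z n - (A / Z * real n + B / Z))
          = \<bar>(x n - (A * real n + B)) * Z - (A * real n + B) * (z n - Z)\<bar> / (Z * z n)"
        unfolding eq real_norm_def abs_divide using Z zn by (simp only: abs_mult abs_of_pos)
      also have "\<dots> \<le> ?f n / (Z * (Z / 2))"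
        using Z by (intro frac_le f0 num den) simp
      also have "\<dots> = 2 / Z\<^sup>2 * norm (?f n)" using f0 Z
        by (simp add: power2_eq_square field_simps)
      finally show ?case .
    qed
  qed
  also have "?f \<in> O(\<lambda>n. \<theta> ^ n)" by (rule linear_times_geometric_bounded[OF \<gamma>(1,2)])
  finally show ?thesis using \<gamma>(3,4) divide_pos_pos[OF A Z] by blast
qed

section \<open>The automaton of legal decompositions\<close>

text \<open>A digit below the next coefficient closes a block and returns to state 0. State
  \<open>length c\<close> is dead, so no block reproduces all of \<open>c\<close>; stopping in any
  other state is allowed, which accounts for rule \<open>partial\<close> of
  \<open>legal\<close>.\<close>

primrec admissible :: "nat list \<Rightarrow> nat \<Rightarrow> nat list \<Rightarrow> bool" where
  "admissible c j [] \<longleftrightarrow> j < length c"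
| "admissible c j (x # a) \<longleftrightarrow> j < length c \<and>
     (x < c ! j \<and> admissible c 0 a \<or> x = c ! j \<and> admissible c (Suc j) a)"

lemma admissible_state: "admissible c j a \<Longrightarrow> j < length c"
  by (cases a) auto

text \<open>Follow the word up to the first digit below its coefficient. Either the word ends before
  one occurs, or that digit closes a block: these are the two rules of \<open>legal\<close>.\<close>

lemma admissible_drop:
  "admissible c j a \<Longrightarrow> (\<exists>n<length c - j. a = take n (drop j c)) \<or>
    (\<exists>i x b. j + i < length c \<and> x < c ! (j + i) \<and> a = take i (drop j c) @ [x] @ b \<and> admissible c 0 b)"
proof (induction a arbitrary: j)
  case (Cons y a)
  have j: "drop j c = c ! j # drop (Suc j) c" using Cons.prems by (simp add: Cons_nth_drop_Suc)
  from Cons.prems consider "y < c ! j" "admissible c 0 a" | "y = c ! j" "admissible c (Suc j) a" by auto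
  then show ?case
  proof cases
    case 1
    then show ?thesis using Cons.prems by (intro disjI2 exI[of _ 0] exI[of _ y] exI[of _ a]) auto
  next
    case 2
    from Cons.IH[OF 2(2)] show ?thesis
    proof (elim disjE exE conjE)
      fix i x b assume "Suc j + i < length c" "x < c ! (Suc j + i)"
        "a = take i (drop (Suc j) c) @ [x] @ b" "admissible c 0 b"
      then show ?thesis using 2 j
        by (intro disjI2 exI[of _ "Suc i"] exI[of _ x] exI[of _ b]) auto
    next
      fix n assume "n < length c - Suc j" "a = take n (drop (Suc j) c)"
      then show ?thesis using 2 j by (intro disjI1 exI[of _ "Suc n"]) auto
    qed
  qed
qed (auto intro!: disjI1 exI[of _ 0])

lemma admissible_take:
  "j + n < length c \<Longrightarrow> admissible c j (take n (drop j c))"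
proof (induction n arbitrary: j)
  case (Suc n)
  then show ?case using Suc.IH[of "Suc j"] by (simp add: Cons_nth_drop_Suc[symmetric])
qed auto

lemma admissible_block:
  "j + i < length c \<Longrightarrow> x < c ! (j + i) \<Longrightarrow> admissible c 0 b \<Longrightarrow>
    admissible c j (take i (drop j c) @ [x] @ b)"
proof (induction i arbitrary: j)
  case (Suc i)
  then show ?case using Suc.IH[of "Suc j"] by (simp add: Cons_nth_drop_Suc[symmetric])
qed auto

lemma admissible_zeros:
  assumes "c \<noteq> []" "c ! 0 > 0"
  shows "admissible c 0 (replicate l 0 @ b) \<longleftrightarrow> admissible c 0 b"
  using assms by (induction l) auto

lemma legal_imp_admissible:
  assumes "c \<noteq> []" "c ! 0 > 0" "legal c a"
  shows "admissible c 0 a \<and> a \<noteq> [] \<and> hd a > 0"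
  using assms(3)
proof induction
  case (partial a)
  show ?case using admissible_take[of 0 "length a" c] partial(1-3) by (simp flip: partial(4))
next
  case (block j x a l b)
  have "admissible c 0 (replicate l 0 @ b)"
    using block assms by (subst admissible_zeros) auto
  then show ?case using admissible_block[of 0 j c x] block by auto
qed

lemma admissible_imp_legal:
  assumes "c \<noteq> []" "c ! 0 > 0"
  shows "admissible c 0 a \<Longrightarrow> a \<noteq> [] \<Longrightarrow> hd a > 0 \<Longrightarrow> legal c a"
proof (induction "length a" arbitrary: a rule: less_induct)
  case less
  from admissible_drop[OF less.prems(1)] show ?case
  proof (elim disjE exE conjE)
    fix n assume n: "n < length c - 0" "a = take n (drop 0 c)"
    then have "a = take (length a) c" "length a < length c" by simp_all
    with less.prems(2,3) show ?thesis by (intro legal.partial)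
  next
    fix j x b assume j: "0 + j < length c" "x < c ! (0 + j)"
      and a: "a = take j (drop 0 c) @ [x] @ b" and b: "admissible c 0 b"
    \<comment> \<open>The zeros after the first block are stripped to serve as the zero run of rule
      \<open>block\<close>. The rest is empty or starts with a positive digit, as the induction
      hypothesis requires.\<close>
    define l where "l = length (takeWhile (\<lambda>x. x = 0) b)"
    define b' where "b' = dropWhile (\<lambda>x. x = 0) b"
    have "takeWhile (\<lambda>x. x = 0) b = replicate l 0"
      unfolding l_def using set_takeWhileD[of _ "\<lambda>x. x = 0" b]
      by (intro replicate_length_same[symmetric]) blast
    then have bb: "b = replicate l 0 @ b'" unfolding b'_def using takeWhile_dropWhile_id[of "\<lambda>x. x = 0" b] by simp
    have b': "b' = [] \<or> legal c b'"
    proof (cases "b' = []")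
      case False
      then have "hd b' > 0" unfolding b'_def using hd_dropWhile by blast
      moreover have "admissible c 0 b'" using b bb admissible_zeros[OF assms] by simp
      moreover have "length b' < length a" using a bb by simp
      ultimately show ?thesis using less.hyps False by blast
    qed simp
    show ?thesis
      by (rule legal.block[of j c x a l b']) (use j a bb b' less.prems in auto)
  qed
qed

lemma legal_iff_admissible:
  assumes "c \<noteq> []" "c ! 0 > 0"
  shows "legal c a \<longleftrightarrow> admissible c 0 a \<and> a \<noteq> [] \<and> hd a > 0"
  using legal_imp_admissible[OF assms] admissible_imp_legal[OF assms] by blast

section \<open>Counting admissible words\<close>

definition adm_lists :: "nat list \<Rightarrow> nat \<Rightarrow> nat \<Rightarrow> nat list set" where
  "adm_lists c j n = {a. length a = n \<and> admissible c j a}"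

lemma adm_lists_0: "adm_lists c j 0 = (if j < length c then {[]} else {})"
  by (auto simp: adm_lists_def)

lemma adm_lists_beyond: "length c \<le> j \<Longrightarrow> adm_lists c j n = {}"
  by (auto simp: adm_lists_def dest: admissible_state)

lemma adm_lists_Suc:
  assumes "j < length c"
  shows "adm_lists c j (Suc n) =
    (\<Union>x<c ! j. (#) x ` adm_lists c 0 n) \<union> (#) (c ! j) ` adm_lists c (Suc j) n"
proof (intro set_eqI)
  fix a show "a \<in> adm_lists c j (Suc n) \<longleftrightarrow>
      a \<in> (\<Union>x<c ! j. (#) x ` adm_lists c 0 n) \<union> (#) (c ! j) ` adm_lists c (Suc j) n"
    using assms by (cases a) (auto simp: adm_lists_def)
qed

lemma finite_adm_lists [simp]: "finite (adm_lists c j n)"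
proof (induction n arbitrary: j)
  case (Suc n)
  then show ?case by (cases "j < length c") (simp_all add: adm_lists_Suc adm_lists_beyond)
qed (simp add: adm_lists_0)

lemma sum_adm_lists_Suc:
  fixes f :: "nat list \<Rightarrow> 'b::comm_monoid_add"
  assumes "j < length c"
  shows "sum f (adm_lists c j (Suc n)) =
    (\<Sum>x<c ! j. \<Sum>a\<in>adm_lists c 0 n. f (x # a)) + (\<Sum>a\<in>adm_lists c (Suc j) n. f (c ! j # a))"
  unfolding adm_lists_Suc[OF assms]
  by (subst sum.union_disjoint, simp, simp, force)
    (subst sum.UNION_disjoint, auto simp: sum.reindex)

definition adm_count :: "nat list \<Rightarrow> nat \<Rightarrow> nat \<Rightarrow> nat" where
  "adm_count c j n = card (adm_lists c j n)"

lemma adm_count_0: "adm_count c j 0 = of_bool (j < length c)"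
  by (simp add: adm_count_def adm_lists_0)

lemma adm_count_beyond: "length c \<le> j \<Longrightarrow> adm_count c j n = 0"
  by (simp add: adm_count_def adm_lists_beyond)

lemma adm_count_Suc:
  "j < length c \<Longrightarrow> adm_count c j (Suc n) = c ! j * adm_count c 0 n + adm_count c (Suc j) n"
  using sum_adm_lists_Suc[of j c "\<lambda>_. 1::nat" n] by (simp add: adm_count_def)

text \<open>Eliminates the states 0 up to \<open>j - 1\<close> in turn. For statistics that vanish
  in the dead state, \<open>j = length c\<close> gives the recurrence of \<open>G\<close> for
  \<open>F 0\<close>, with the terms \<open>E\<close> as forcing.\<close>

lemma unroll_states:
  fixes F :: "nat \<Rightarrow> nat \<Rightarrow> 'b::comm_semiring_1"
  assumes "\<And>j n. j < length c \<Longrightarrow> F j (Suc n) = of_nat (c ! j) * F 0 n + F (Suc j) n + E j n"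
    and "j \<le> length c"
  shows "F 0 (n + j) = (\<Sum>i<j. of_nat (c ! i) * F 0 (n + (j - Suc i)))
    + (\<Sum>i<j. E i (n + (j - Suc i))) + F j n"
  using assms(2)
proof (induction j arbitrary: n)
  case (Suc j)
  have shift: "(\<Sum>i<j. f i (Suc n + (j - Suc i))) = (\<Sum>i<j. f i (n + (Suc j - Suc i)))"
    for f :: "nat \<Rightarrow> nat \<Rightarrow> 'b"
    by (intro sum.cong refl arg_cong2[of _ _ _ _ f]) auto
  have "F 0 (n + Suc j) = F 0 (Suc n + j)" by simp
  also have "\<dots> = (\<Sum>i<j. of_nat (c ! i) * F 0 (n + (Suc j - Suc i)))
    + (\<Sum>i<j. E i (n + (Suc j - Suc i))) + F j (Suc n)"
    using Suc.IH[of "Suc n"] Suc.prems shift[of "\<lambda>i. E i"] shift[of "\<lambda>i m. of_nat (c ! i) * F 0 m"] by simp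
  finally show ?case using Suc.prems assms(1)[of j n] by (simp add: ac_simps)
qed simp

text \<open>For \<open>n < length c\<close> unroll \<open>n\<close> states: the word that matches
  \<open>c\<close> to its end reaches length 0 in the live state \<open>n\<close> and supplies the
  \<open>+ 1\<close> of the initial conditions. For larger \<open>n\<close> unroll all states, and
  the dead state contributes nothing.\<close>

lemma plrs_eq_adm_count:
  assumes "plrs c G"
  shows "G (Suc n) = adm_count c 0 n"
proof (induction n rule: less_induct)
  case (less n)
  have c: "c \<noteq> []" using assms by (auto simp: plrs_def)
  have unroll: "adm_count c 0 (m + j) = (\<Sum>i<j. c ! i * adm_count c 0 (m + (j - Suc i))) + adm_count c j m"
    if "j \<le> length c" for m j
    using unroll_states[of c "adm_count c" "\<lambda>_ _. 0" j m] that by (simp add: adm_count_Suc)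
  have shift: "(\<Sum>i\<in>{1..<Suc k}. c ! (i - 1) * G (Suc n - i)) = (\<Sum>i<k. c ! i * adm_count c 0 (n - Suc i))"
    if "k \<le> n" for k
  proof -
    have "(\<Sum>i\<in>{1..<Suc k}. c ! (i - 1) * G (Suc n - i)) = (\<Sum>i<k. c ! i * G (n - i))"
      by (simp add: sum.shift_bounds_Suc_ivl lessThan_atLeast0 del: sum.op_ivl_Suc)
    also have "\<dots> = (\<Sum>i<k. c ! i * adm_count c 0 (n - Suc i))"
    proof (intro sum.cong refl)
      fix i assume "i \<in> {..<k}"
      then have "n - i = Suc (n - Suc i)" "n - Suc i < n" using that by auto
      then show "c ! i * G (n - i) = c ! i * adm_count c 0 (n - Suc i)" using less by metis
    qed
    finally show ?thesis .
  qed
  show ?case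
  proof (cases "Suc n \<le> length c")
    case True
    then have "G (Suc n) = (\<Sum>i\<in>{1..<Suc n}. c ! (i - 1) * G (Suc n - i)) + 1"
      using assms by (simp add: plrs_def)
    then show ?thesis using True unroll[of n 0] shift[of n] by (simp add: adm_count_0)
  next
    case False
    then have "G (Suc n) = (\<Sum>i\<in>{1..<Suc (length c)}. c ! (i - 1) * G (Suc n - i))"
      using assms unfolding plrs_def atLeastLessThanSuc_atLeastAtMost by (meson not_le)
    also have "\<dots> = (\<Sum>i<length c. c ! i * adm_count c 0 (n - length c + (length c - Suc i)))"
      using False by (subst shift) (auto intro!: sum.cong arg_cong2[of _ _ _ _ "(*)"] arg_cong[of _ _ "adm_count c 0"])
    finally show ?thesis using False unroll[of "length c" "n - length c"] by (simp add: adm_count_beyond)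
  qed
qed

section \<open>Values of words and uniqueness of legal decompositions\<close>

lemma decomp_value_Nil: "decomp_value G [] = 0"
  by (simp add: decomp_value_def)

lemma decomp_value_Cons: "decomp_value G (x # a) = x * G (Suc (length a)) + decomp_value G a"
proof -
  have "decomp_value G (x # a) = (\<Sum>i\<in>{Suc 0..Suc (length a)}. (x # a) ! (i - 1) * G (Suc (length a) + 1 - i))"
    by (simp add: decomp_value_def)
  also have "\<dots> = x * G (Suc (length a)) + (\<Sum>i\<in>{Suc (Suc 0)..Suc (length a)}. (x # a) ! (i - 1) * G (Suc (length a) + 1 - i))"
    by (subst sum.atLeast_Suc_atMost) auto
  also have "(\<Sum>i\<in>{Suc (Suc 0)..Suc (length a)}. (x # a) ! (i - 1) * G (Suc (length a) + 1 - i)) = decomp_value G a"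
    unfolding decomp_value_def sum.shift_bounds_cl_Suc_ivl
    by (intro sum.cong) (auto simp: nth_Cons')
  finally show ?thesis .
qed

text \<open>With \<open>V\<close> words after a reset, leading digit \<open>x < c ! j\<close> covers
  the values from \<open>x * V\<close> up to \<open>(x + 1) * V\<close>, and leading digit
  \<open>c ! j\<close> covers what lies above. Only covering is checked directly; injectivity and
  equality of the image follow by cardinality.\<close>

lemma bij_betw_decomp_value:
  assumes G: "\<And>n. G (Suc n) = adm_count c 0 n"
  shows "bij_betw (decomp_value G) (adm_lists c j n) {..<adm_count c j n}"
proof (induction n arbitrary: j)
  case 0
  then show ?case by (simp add: adm_lists_0 adm_count_0 decomp_value_Nil bij_betw_def lessThan_Suc)
next
  case (Suc n)
  show ?case
  proof (cases "j < length c")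
    case True
    let ?V = "adm_count c 0 n"
    have val: "decomp_value G (x # a) = x * ?V + decomp_value G a" if "length a = n" for x a
      using that by (simp add: decomp_value_Cons G)
    have len: "length a = n" if "a \<in> adm_lists c i n" for i a using that by (simp add: adm_lists_def)
    have B0: "inj_on (decomp_value G) (adm_lists c 0 n)" "decomp_value G ` adm_lists c 0 n = {..<?V}"
      using Suc.IH[of 0] by (auto simp: bij_betw_def)
    have B1: "inj_on (decomp_value G) (adm_lists c (Suc j) n)"
      "decomp_value G ` adm_lists c (Suc j) n = {..<adm_count c (Suc j) n}"
      using Suc.IH[of "Suc j"] by (auto simp: bij_betw_def)
    have lt: "decomp_value G a < ?V" if "a \<in> adm_lists c 0 n" for a using B0 that by blast
    have img: "{..<adm_count c j (Suc n)} \<subseteq> decomp_value G ` adm_lists c j (Suc n)"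
    proof
      fix M assume M: "M \<in> {..<adm_count c j (Suc n)}"
      show "M \<in> decomp_value G ` adm_lists c j (Suc n)"
      proof (cases "M < c ! j * ?V")
        case lt: True
        then have V0: "0 < ?V" by (cases "?V = 0") auto
        then obtain a where a: "a \<in> adm_lists c 0 n" "decomp_value G a = M mod ?V"
          using B0(2) by (metis imageE lessThan_iff mod_less_divisor)
        have "M div ?V < c ! j" using lt V0 by (simp add: less_mult_imp_div_less)
        moreover have "decomp_value G (M div ?V # a) = M" using a len by (simp add: val)
        ultimately show ?thesis unfolding adm_lists_Suc[OF True]
          using a(1) by (intro image_eqI[of _ _ "M div ?V # a"]) auto
      next
        case ge: False
        then have "M - c ! j * ?V \<in> {..<adm_count c (Suc j) n}" using M True by (auto simp: adm_count_Suc)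
        then obtain a where a: "a \<in> adm_lists c (Suc j) n" "decomp_value G a = M - c ! j * ?V"
          using B1(2) by (metis imageE)
        then have "decomp_value G (c ! j # a) = M" using len ge by (simp add: val)
        then show ?thesis unfolding adm_lists_Suc[OF True]
          using a(1) by (intro image_eqI[of _ _ "c ! j # a"]) auto
      qed
    qed
    have "card (adm_lists c j (Suc n)) \<le> card {..<adm_count c j (Suc n)}" by (simp add: adm_count_def)
    moreover have "card {..<adm_count c j (Suc n)} \<le> card (decomp_value G ` adm_lists c j (Suc n))"
      using img by (intro card_mono) auto
    moreover have "card (decomp_value G ` adm_lists c j (Suc n)) \<le> card (adm_lists c j (Suc n))"
      by (intro card_image_le) auto
    ultimately have card: "card (decomp_value G ` adm_lists c j (Suc n)) = card (adm_lists c j (Suc n))"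
      "card {..<adm_count c j (Suc n)} = card (decomp_value G ` adm_lists c j (Suc n))" by linarith+
    then show ?thesis unfolding bij_betw_def
      using card_subset_eq[OF _ img] by (auto intro: eq_card_imp_inj_on)
  qed (simp add: adm_lists_beyond adm_count_beyond bij_betw_def)
qed

lemma adm_count_le_Suc:
  assumes "c \<noteq> []" "c ! 0 > 0"
  shows "adm_count c 0 n \<le> adm_count c 0 (Suc n)"
  using assms by (cases "c ! 0") (auto simp: adm_count_Suc)

text \<open>The value determines the length, because intervals between consecutive \<open>G\<close>
  values are disjoint for different lengths; among words of one length the value map is
  injective.\<close>

lemma legal_decomp_eq:
  assumes G: "plrs c G" and a: "legal c a"
  shows "legal_decomp c G (decomp_value G a) = a"
    and "decomp_value G a \<in> {G (length a)..<G (Suc (length a))}"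
proof -
  have c: "c \<noteq> []" using G by (auto simp: plrs_def)
  moreover have "c ! 0 > 0" using G c by (auto simp: plrs_def hd_conv_nth)
  ultimately have c: "c \<noteq> []" "c ! 0 > 0" by blast+
  note GV = plrs_eq_adm_count[OF G]
  have range: "decomp_value G b \<in> {G (length b)..<G (Suc (length b))}" if "legal c b" for b
  proof -
    have b: "admissible c 0 b" "b \<noteq> []" "hd b > 0" using that legal_iff_admissible[OF c] by auto
    then have "decomp_value G b < adm_count c 0 (length b)"
      using bij_betw_decomp_value[of G c 0 "length b"] GV by (auto simp: bij_betw_def adm_lists_def)
    moreover have "G (length b) \<le> decomp_value G b"
      using b by (cases b) (auto simp: decomp_value_Cons intro!: trans_le_add1)
    ultimately show ?thesis by (simp add: GV)
  qed
  then show "decomp_value G a \<in> {G (length a)..<G (Suc (length a))}" using a by blast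
  have mono: "G (Suc m) \<le> G (Suc n)" if "m \<le> n" for m n
    unfolding GV using that adm_count_le_Suc[OF c] by (rule lift_Suc_mono_le[rotated])
  show "legal_decomp c G (decomp_value G a) = a" unfolding legal_decomp_def
  proof (rule the_equality)
    fix b assume b: "legal c b \<and> decomp_value G b = decomp_value G a"
    have "length b = length a"
    proof (rule ccontr)
      assume "length b \<noteq> length a"
      moreover have False if "length u < length v" "legal c u" "legal c v" "decomp_value G u = decomp_value G v" for u v
      proof -
        obtain k where "length v = Suc k" "length u \<le> k" using \<open>length u < length v\<close> by (cases "length v") auto
        then have "G (Suc (length u)) \<le> G (length v)" using mono by simp
        with range[OF that(2)] range[OF that(3)] that(4) show False by auto
      qed
      ultimately show False using a b by (metis linorder_less_linear)
    qed
    then have "a \<in> adm_lists c 0 (length a)" "b \<in> adm_lists c 0 (length a)"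
      using a b legal_iff_admissible[OF c] by (auto simp: adm_lists_def)
    then show "b = a" using bij_betw_decomp_value[of G c 0 "length a"] GV b
      by (auto simp: bij_betw_def dest: inj_onD)
  qed (use a in simp)
qed

section \<open>Gap statistics\<close>

text \<open>Positions count from 0, so a positive digit placed directly in front has a gap of
  \<open>k + 1\<close> to this one. Hence the \<open>g - 1\<close> in
  \<open>head_gaps\<close>.\<close>

primrec first_nonzero :: "nat \<Rightarrow> nat list \<Rightarrow> bool" where
  "first_nonzero k [] \<longleftrightarrow> False"
| "first_nonzero k (x # a) \<longleftrightarrow> (if x = 0 then k > 0 \<and> first_nonzero (k - 1) a else k = 0)"

lemma first_nonzero_append: "first_nonzero k a \<Longrightarrow> first_nonzero k (a @ b)"
  by (induction a arbitrary: k) (auto split: if_splits)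

text \<open>The number of gaps \<open>g\<close> whose larger index comes from the leading coefficient \<open>x\<close> of \<open>x # a\<close>.\<close>

definition head_gaps :: "nat \<Rightarrow> nat \<Rightarrow> nat list \<Rightarrow> nat" where
  "head_gaps g x a = (if x = 0 then 0 else if g = 0 then x - 1 else of_bool (first_nonzero (g - 1) a))"

primrec gap_count :: "nat \<Rightarrow> nat list \<Rightarrow> nat" where
  "gap_count g [] = 0"
| "gap_count g (x # a) = head_gaps g x a + gap_count g a"

lemma summand_indices_Nil: "summand_indices [] = []"
  by (simp add: summand_indices_def)

lemma summand_indices_Cons:
  "summand_indices (x # a) = replicate x (Suc (length a)) @ summand_indices a"
proof -
  have "[1..<length (x # a) + 1] = 1 # map Suc [1..<length a + 1]"
    by (simp add: upt_conv_Cons map_Suc_upt del: upt_Suc)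
  then show ?thesis
    unfolding summand_indices_def
    by (auto simp: nth_Cons' simp del: upt_Suc intro!: arg_cong[of _ _ concat])
qed

lemma hd_summand_indices: "summand_indices a \<noteq> [] \<Longrightarrow> hd (summand_indices a) \<le> length a"
  by (induction a) (auto simp: summand_indices_Nil summand_indices_Cons hd_append)

lemma first_nonzero_iff:
  "first_nonzero k a \<longleftrightarrow> summand_indices a \<noteq> [] \<and> length a - hd (summand_indices a) = k"
proof (induction a arbitrary: k)
  case (Cons x a)
  show ?case
  proof (cases x)
    case 0
    have "summand_indices a \<noteq> [] \<Longrightarrow>
        Suc (length a) - hd (summand_indices a) = Suc (length a - hd (summand_indices a))"
      using hd_summand_indices[of a] by (simp add: Suc_diff_le)
    with 0 show ?thesis using Cons.IH[of "k - 1"] by (cases k) (auto simp: summand_indices_Cons)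
  next
    case (Suc y)
    then show ?thesis by (auto simp: summand_indices_Cons)
  qed
qed (simp add: summand_indices_Nil)

lemma gaps_simps [simp]:
  "gaps [] = []" "gaps [i] = []" "gaps (i # j # js) = (i - j) # gaps (j # js)"
  by (simp_all add: gaps_def)

text \<open>\<open>x + 1\<close> equal indices produce \<open>x\<close> gaps of size 0 among
  themselves and one gap to the next index, if there is one.\<close>

lemma count_gaps_replicate:
  "count_list (gaps (replicate (Suc x) m @ js)) g =
    (if g = 0 then x else 0) + of_bool (js \<noteq> [] \<and> m - hd js = g) + count_list (gaps js) g"
proof (induction x)
  case 0
  then show ?case by (cases js) auto
qed auto

lemma gap_count_eq: "gap_count g a = count_list (gaps (summand_indices a)) g"
proof (induction a)
  case (Cons x a)
  show ?case
  proof (cases x)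
    case (Suc y)
    have "summand_indices a \<noteq> [] \<and> Suc (length a) - hd (summand_indices a) = g
        \<longleftrightarrow> g \<noteq> 0 \<and> first_nonzero (g - 1) a"
      using hd_summand_indices[of a] by (auto simp: first_nonzero_iff)
    then show ?thesis
      using Suc Cons.IH count_gaps_replicate[of y "Suc (length a)" "summand_indices a" g]
      by (simp add: summand_indices_Cons head_gaps_def)
  qed (use Cons in \<open>simp add: summand_indices_Cons head_gaps_def\<close>)
qed (simp add: summand_indices_Nil)

section \<open>Totals of the gap statistics over all admissible words\<close>

definition gap_total :: "nat list \<Rightarrow> nat \<Rightarrow> nat \<Rightarrow> nat \<Rightarrow> nat" where
  "gap_total c g j n = (\<Sum>a\<in>adm_lists c j n. gap_count g a)"

text \<open>The argument \<open>n\<close> is the length after the leading digit is removed, so that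
  this total is the forcing \<open>E j n\<close> of \<open>unroll_states\<close>.\<close>

definition head_gap_total :: "nat list \<Rightarrow> nat \<Rightarrow> nat \<Rightarrow> nat \<Rightarrow> nat" where
  "head_gap_total c g j n = (\<Sum>a\<in>adm_lists c j (Suc n). head_gaps g (hd a) (tl a))"

definition first_nonzero_count :: "nat list \<Rightarrow> nat \<Rightarrow> nat \<Rightarrow> nat \<Rightarrow> nat" where
  "first_nonzero_count c k j n = (\<Sum>a\<in>adm_lists c j n. of_bool (first_nonzero k a))"

lemma gap_total_Suc:
  assumes "j < length c"
  shows "gap_total c g j (Suc n) =
    c ! j * gap_total c g 0 n + gap_total c g (Suc j) n + head_gap_total c g j n"
  using assms by (simp add: gap_total_def head_gap_total_def sum_adm_lists_Suc sum.distrib)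

lemma sum_lessThan_nonzero:
  fixes v w :: nat
  assumes "0 < m"
  shows "(\<Sum>x<m. if x = 0 then w else v) = w + (m - 1) * v"
  using assms by (cases m) (simp_all add: sum.lessThan_Suc_shift del: sum.lessThan_Suc)

lemma first_nonzero_count_0_Suc:
  assumes "j < length c" "0 < c ! j"
  shows "first_nonzero_count c 0 j (Suc n) = (c ! j - 1) * adm_count c 0 n + adm_count c (Suc j) n"
proof -
  have "(\<Sum>a\<in>A. of_bool (first_nonzero 0 (x # a))) = (if x = 0 then 0 else card A)"
    for x and A :: "nat list set"
    by (cases x) auto
  then show ?thesis using assms(2)
    by (simp add: first_nonzero_count_def sum_adm_lists_Suc[OF assms(1)] adm_count_def
        sum_lessThan_nonzero del: sum_of_bool_eq first_nonzero.simps)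
qed

text \<open>The leading digit must be 0, and since \<open>c ! j\<close> is positive this digit is a
  reset, not a match.\<close>

lemma first_nonzero_count_Suc_Suc:
  assumes "j < length c" "0 < c ! j"
  shows "first_nonzero_count c (Suc k) j (Suc n) = first_nonzero_count c k 0 n"
proof -
  have "(\<Sum>a\<in>A. of_bool (first_nonzero (Suc k) (x # a)) :: nat)
      = (if x = 0 then (\<Sum>a\<in>A. of_bool (first_nonzero k a)) else 0)"
    for x and A :: "nat list set"
    by (cases x) auto
  then show ?thesis using assms(2)
    by (simp add: first_nonzero_count_def sum_adm_lists_Suc[OF assms(1)]
        sum_lessThan_nonzero del: sum_of_bool_eq first_nonzero.simps)
qed

lemma head_gap_total_0:
  assumes "j < length c"
  shows "head_gap_total c 0 j n =
    (\<Sum>x<c ! j. x - 1) * adm_count c 0 n + (c ! j - 1) * adm_count c (Suc j) n"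
proof -
  have "(\<Sum>a\<in>A. head_gaps 0 x a) = (x - 1) * card A" for x and A :: "nat list set"
    by (cases x) (simp_all add: head_gaps_def)
  then show ?thesis using assms
    by (simp add: head_gap_total_def sum_adm_lists_Suc adm_count_def sum_distrib_right)
qed

lemma head_gap_total_Suc:
  assumes "j < length c" "0 < c ! j"
  shows "head_gap_total c (Suc k) j n =
    (c ! j - 1) * first_nonzero_count c k 0 n + first_nonzero_count c k (Suc j) n"
proof -
  have "(\<Sum>a\<in>A. head_gaps (Suc k) x a) = (if x = 0 then 0 else (\<Sum>a\<in>A. of_bool (first_nonzero k a)))"
    for x and A :: "nat list set"
    by (cases x) (simp_all add: head_gaps_def)
  then show ?thesis using assms(2)
    by (simp add: head_gap_total_def sum_adm_lists_Suc[OF assms(1)] first_nonzero_count_def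
        sum_lessThan_nonzero del: sum_of_bool_eq)
qed

lemma admissible_append_zero:
  assumes "\<forall>x\<in>set c. x > 0" "admissible c j a" "admissible c 0 b"
  shows "admissible c j (a @ 0 # b)"
  using assms(2) by (induction a arbitrary: j) (use assms in auto)

lemma gap_count_pos_imp_head_gaps_pos:
  "admissible c j a \<Longrightarrow> gap_count g a > 0 \<Longrightarrow>
    \<exists>i x a'. admissible c i (x # a') \<and> head_gaps g x a' > 0"
proof (induction a arbitrary: j)
  case (Cons x a)
  show ?case
  proof (cases "head_gaps g x a > 0")
    case True
    with Cons.prems show ?thesis by blast
  next
    case False
    then have "gap_count g a > 0" using Cons.prems by simp
    with Cons.IH[of 0] Cons.IH[of "Suc j"] Cons.prems show ?thesis by auto
  qed
qed simp

text \<open>Since all \<open>c\<^sub>i\<close> are positive, a zero digit is admissible in every state and resets the automaton,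
  so anything may follow a word containing a gap. This makes the constant \<open>C\<close> positive.\<close>

lemma head_gap_total_lower_bound:
  assumes c: "\<forall>x\<in>set c. x > 0" and a: "admissible c j (x # a)" "head_gaps g x a > 0"
  shows "adm_count c 0 n \<le> head_gap_total c g j (Suc (length a) + n)"
proof -
  let ?f = "\<lambda>b. x # a @ 0 # b"
  have "adm_count c 0 n = (\<Sum>b\<in>?f ` adm_lists c 0 n. 1)"
    by (simp add: adm_count_def card_image inj_on_def)
  also have "\<dots> \<le> (\<Sum>b\<in>?f ` adm_lists c 0 n. head_gaps g (hd b) (tl b))"
  proof (rule sum_mono)
    fix b assume "b \<in> ?f ` adm_lists c 0 n"
    then obtain b' where "b = ?f b'" by blast
    then show "1 \<le> head_gaps g (hd b) (tl b)"
      using a(2) first_nonzero_append[of "g - 1" a "0 # b'"] by (auto simp: head_gaps_def split: if_splits)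
  qed
  also have "\<dots> \<le> head_gap_total c g j (Suc (length a) + n)" unfolding head_gap_total_def
    using admissible_append_zero[OF c a(1)] by (intro sum_mono2[OF finite_adm_lists]) (auto simp: adm_lists_def)
  finally show ?thesis .
qed

section \<open>Asymptotics\<close>

text \<open>\<open>1 / \<rho>\<close> is the positive root of the characteristic polynomial. In
  terms of \<open>\<rho>\<close> the characteristic equation says that the scaled coefficients form
  a probability distribution.\<close>

locale growth_rate =
  fixes c :: "nat list" and \<rho> :: real
  assumes coeffs_pos: "\<forall>x\<in>set c. x > 0" and nonempty: "c \<noteq> []"
    and \<rho>: "0 < \<rho>" "\<rho> < 1" "(\<Sum>i<length c. real (c ! i) * \<rho> ^ Suc i) = 1"
begin

text \<open>Indexed in reverse, so that the recurrence expresses the value at \<open>n + L\<close> by those at \<open>n + i\<close>.\<close>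

definition weight :: "nat \<Rightarrow> real" where
  "weight i = real (c ! (length c - Suc i)) * \<rho> ^ (length c - i)"

lemma weight_pos: "i < length c \<Longrightarrow> 0 < weight i"
  using coeffs_pos \<rho> by (simp add: weight_def)

lemma sum_weight: "(\<Sum>i<length c. weight i) = 1"
proof -
  have "(\<Sum>i<length c. weight i) = (\<Sum>i<length c. weight (length c - Suc i))"
    by (rule sum.nat_diff_reindex[symmetric])
  also have "\<dots> = (\<Sum>i<length c. real (c ! i) * \<rho> ^ Suc i)"
    by (intro sum.cong refl) (simp add: weight_def)
  finally show ?thesis using \<rho> by simp
qed

text \<open>Stated with forcing \<open>E\<close> to serve twice: with \<open>E = 0\<close> for the
  number of words, and with \<open>head_gap_total\<close> for the total number of gaps.\<close>

lemma scaled_renewal: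
  fixes F E :: "nat \<Rightarrow> nat \<Rightarrow> nat"
  assumes "\<And>j n. j < length c \<Longrightarrow> F j (Suc n) = c ! j * F 0 n + F (Suc j) n + E j n"
    and "\<And>n. F (length c) n = 0"
  shows "real (F 0 (n + length c)) * \<rho> ^ (n + length c) =
    (\<Sum>i<length c. weight i * (real (F 0 (n + i)) * \<rho> ^ (n + i))) +
    (\<Sum>i<length c. real (E i (n + (length c - Suc i)))) * \<rho> ^ (n + length c)"
proof -
  let ?L = "length c"
  have "F 0 (n + ?L) = (\<Sum>i<?L. c ! i * F 0 (n + (?L - Suc i))) + (\<Sum>i<?L. E i (n + (?L - Suc i)))"
    using unroll_states[of c F E ?L n] assms by simp
  also have "(\<Sum>i<?L. c ! i * F 0 (n + (?L - Suc i))) = (\<Sum>i<?L. c ! (?L - Suc i) * F 0 (n + i))"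
    by (subst (2) sum.nat_diff_reindex[symmetric]) (intro sum.cong, auto)
  finally have "real (F 0 (n + ?L)) * \<rho> ^ (n + ?L) =
      (\<Sum>i<?L. real (c ! (?L - Suc i)) * real (F 0 (n + i)) * \<rho> ^ (n + ?L)) +
      (\<Sum>i<?L. real (E i (n + (?L - Suc i)))) * \<rho> ^ (n + ?L)"
    by (simp add: algebra_simps sum_distrib_left sum_distrib_right)
  also have "(\<Sum>i<?L. real (c ! (?L - Suc i)) * real (F 0 (n + i)) * \<rho> ^ (n + ?L)) =
      (\<Sum>i<?L. weight i * (real (F 0 (n + i)) * \<rho> ^ (n + i)))"
  proof (intro sum.cong refl)
    fix i assume "i \<in> {..<?L}"
    then have "\<rho> ^ (n + ?L) = \<rho> ^ (?L - i) * \<rho> ^ (n + i)" by (simp add: add.commute flip: power_add)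
    then show "real (c ! (?L - Suc i)) * real (F 0 (n + i)) * \<rho> ^ (n + ?L) =
        weight i * (real (F 0 (n + i)) * \<rho> ^ (n + i))" by (simp add: weight_def)
  qed
  finally show ?thesis .
qed

text \<open>The limit is left unnamed: for the forcing terms closure under sums, multiples and
  shifts suffices, and positivity of the limits that matter is obtained separately from lower
  bounds.\<close>

definition regular :: "(nat \<Rightarrow> real) \<Rightarrow> bool" where
  "regular f \<longleftrightarrow> (\<exists>l. geom_conv (\<lambda>n. f n * \<rho> ^ n) l)"

lemma regular_0: "regular (\<lambda>n. 0)"
  using geom_conv_const by (auto simp: regular_def)

lemma regular_add: "regular f \<Longrightarrow> regular h \<Longrightarrow> regular (\<lambda>n. f n + h n)"
  using geom_conv_add by (fastforce simp: regular_def distrib_right)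

lemma regular_cmult: "regular f \<Longrightarrow> regular (\<lambda>n. k * f n)"
  using geom_conv_cmult[of _ _ k] by (fastforce simp: regular_def mult.assoc)

lemma regular_sum: "(\<And>i. i \<in> A \<Longrightarrow> regular (f i)) \<Longrightarrow> regular (\<lambda>n. \<Sum>i\<in>A. f i n)"
  by (induction A rule: infinite_finite_induct) (simp_all add: regular_0 regular_add)

lemma regular_Suc_iff: "regular (\<lambda>n. f (Suc n)) \<longleftrightarrow> regular f"
proof
  assume "regular f"
  then obtain l where "geom_conv (\<lambda>n. f n * \<rho> ^ n) l" by (auto simp: regular_def)
  from geom_conv_cmult[OF geom_conv_shift[OF this, of 1], of "1 / \<rho>"]
  show "regular (\<lambda>n. f (Suc n))" using \<rho> by (auto simp: regular_def field_simps)
next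
  assume "regular (\<lambda>n. f (Suc n))"
  then obtain l where "geom_conv (\<lambda>n. f (Suc n) * \<rho> ^ n) l" by (auto simp: regular_def)
  from geom_conv_cmult[OF this, of \<rho>]
  have "geom_conv (\<lambda>n. f (Suc n) * \<rho> ^ Suc n) (\<rho> * l)" by (simp add: mult_ac)
  then show "regular f" unfolding regular_def by (intro exI) (rule geom_conv_unshift)
qed

lemma regular_shift: "regular f \<Longrightarrow> regular (\<lambda>n. f (n + k))"
proof (induction k)
  case (Suc k)
  then show ?case using regular_Suc_iff[of "\<lambda>n. f (n + k)"] by simp
qed simp

lemma scaled_adm_count_renewal:
  "real (adm_count c 0 (n + length c)) * \<rho> ^ (n + length c) =
    (\<Sum>i<length c. weight i * (real (adm_count c 0 (n + i)) * \<rho> ^ (n + i)))"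
  using scaled_renewal[of "adm_count c" "\<lambda>_ _. 0" n] by (simp add: adm_count_Suc adm_count_beyond)

lemma adm_count_pos: "0 < adm_count c 0 n"
proof (induction n)
  case (Suc n)
  then show ?case using adm_count_le_Suc[of c n] nonempty coeffs_pos by simp
qed (simp add: adm_count_0 nonempty)

text \<open>The scaled counts are weighted averages of earlier ones, so the minimum of the first
  \<open>length c\<close> of them remains a lower bound. This makes their limit strictly
  positive.\<close>

lemma scaled_adm_count_lower_bound: "\<exists>m>0. \<forall>n. m \<le> real (adm_count c 0 n) * \<rho> ^ n"
proof -
  define w where "w n = real (adm_count c 0 n) * \<rho> ^ n" for n
  define m where "m = Min (w ` {..<length c})"
  have "m \<le> w n" for n
  proof (induction n rule: less_induct)
    case (less n)
    show ?case
    proof (cases "n < length c")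
      case False
      then obtain k where k: "n = k + length c" by (metis add.commute le_Suc_ex not_less)
      have "m = (\<Sum>i<length c. weight i * m)" by (simp add: sum_distrib_right[symmetric] sum_weight)
      also have "\<dots> \<le> (\<Sum>i<length c. weight i * w (k + i))"
        using less k weight_pos by (intro sum_mono mult_left_mono less_imp_le[OF weight_pos]) auto
      also have "\<dots> = w n" using scaled_adm_count_renewal[of k] by (simp add: w_def k)
      finally show ?thesis .
    qed (simp add: m_def)
  qed
  moreover have "0 < m" unfolding m_def
    using nonempty adm_count_pos \<rho> by (subst Min_gr_iff) (auto simp: w_def lessThan_empty_iff)
  ultimately show ?thesis by (auto simp: w_def)
qed

lemma scaled_adm_count_conv: "\<exists>\<alpha>>0. geom_conv (\<lambda>n. real (adm_count c 0 n) * \<rho> ^ n) \<alpha>"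
proof -
  obtain \<alpha> where \<alpha>: "geom_conv (\<lambda>n. real (adm_count c 0 n) * \<rho> ^ n) \<alpha>"
    using renewal_geom_conv[of _ "length c" weight "\<lambda>_. 0"] scaled_adm_count_renewal
      weight_pos sum_weight geom_conv_const by force
  obtain m where "m > 0" "\<And>n. m \<le> real (adm_count c 0 n) * \<rho> ^ n"
    using scaled_adm_count_lower_bound by blast
  then have "m \<le> \<alpha>" using LIMSEQ_le_const[OF geom_conv_tendsto[OF \<alpha>]] by blast
  with \<alpha> \<open>m > 0\<close> show ?thesis by (intro exI[of _ \<alpha>]) auto
qed

text \<open>The recurrence \<open>adm_count_Suc\<close> read backwards expresses state
  \<open>j + 1\<close> through states \<open>j\<close> and 0.\<close>

lemma regular_adm_count: "regular (\<lambda>n. real (adm_count c j n))"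
proof (induction j)
  case 0
  show ?case using scaled_adm_count_conv by (auto simp: regular_def)
next
  case (Suc j)
  show ?case
  proof (cases "j < length c")
    case True
    have "regular (\<lambda>n. real (adm_count c j (Suc n)) + - real (c ! j) * real (adm_count c 0 n))"
      using Suc scaled_adm_count_conv
      by (intro regular_add regular_cmult) (auto simp: regular_Suc_iff[of "\<lambda>n. real (adm_count c j n)"] regular_def)
    then show ?thesis by (simp add: adm_count_Suc[OF True])
  qed (simp add: adm_count_beyond regular_0)
qed

lemma regular_first_nonzero_count: "regular (\<lambda>n. real (first_nonzero_count c k j n))"
proof (induction k arbitrary: j)
  case 0
  show ?case
  proof (cases "j < length c")
    case True
    then have "0 < c ! j" using coeffs_pos by simp
    with True show ?thesis
      by (subst regular_Suc_iff[symmetric])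
        (simp add: first_nonzero_count_0_Suc regular_add regular_cmult regular_adm_count del: of_nat_diff)
  qed (simp add: first_nonzero_count_def adm_lists_beyond regular_0)
next
  case (Suc k)
  show ?case
  proof (cases "j < length c")
    case True
    then have "0 < c ! j" using coeffs_pos by simp
    with True show ?thesis using Suc[of 0]
      by (subst regular_Suc_iff[symmetric]) (simp add: first_nonzero_count_Suc_Suc)
  qed (simp add: first_nonzero_count_def adm_lists_beyond regular_0)
qed

lemma regular_head_gap_total:
  assumes "j < length c"
  shows "regular (\<lambda>n. real (head_gap_total c g j n))"
proof (cases g)
  case 0
  then show ?thesis using assms
    by (simp add: head_gap_total_0 regular_add regular_cmult regular_adm_count del: of_nat_diff of_nat_sum)
next
  case (Suc k)
  have "0 < c ! j" using coeffs_pos assms by simp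
  then show ?thesis using assms Suc
    by (simp add: head_gap_total_Suc regular_add regular_cmult regular_first_nonzero_count del: of_nat_diff)
qed

lemma scaled_gap_total_conv:
  assumes a: "admissible c 0 a" "gap_count g a > 0"
  shows "\<exists>C d. 0 < C \<and> geom_conv (\<lambda>n. real (gap_total c g 0 n) * \<rho> ^ n - C * real n) d"
proof -
  let ?L = "length c"
  define f where "f n = (\<Sum>i<?L. real (head_gap_total c g i (n + (?L - Suc i))))" for n
  define e where "e n = f n * \<rho> ^ (n + ?L)" for n
  have "regular f" unfolding f_def
    by (intro regular_sum regular_shift regular_head_gap_total) auto
  then obtain l where "geom_conv (\<lambda>n. f n * \<rho> ^ n) l" by (auto simp: regular_def)
  from geom_conv_cmult[OF this, of "\<rho> ^ ?L"] have e: "geom_conv e (\<rho> ^ ?L * l)"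
    by (simp add: e_def[abs_def] power_add mult_ac)
  obtain j x b where b: "admissible c j (x # b)" "head_gaps g x b > 0"
    using gap_count_pos_imp_head_gaps_pos[OF a] by blast
  have j: "j < ?L" using b(1) admissible_state by blast
  obtain m where m: "m > 0" "\<And>n. m \<le> real (adm_count c 0 n) * \<rho> ^ n"
    using scaled_adm_count_lower_bound by blast
  define k where "k = Suc (length b)"
  have "m * \<rho> ^ (k + Suc j) \<le> e n" if "k \<le> n" for n
  proof -
    \<comment> \<open>A single summand, the one for state \<open>j\<close>, already bounds
      \<open>f\<close> from below. \<open>p\<close> counts the free digits that remain after
      \<open>x # b\<close> and the resetting zero.\<close>
    define p where "p = n + (?L - Suc j) - k"
    have p: "n + (?L - Suc j) = k + p" "n + ?L = p + (k + Suc j)" using that j by (auto simp: p_def)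
    have "m * \<rho> ^ (k + Suc j) \<le> real (adm_count c 0 p) * \<rho> ^ p * \<rho> ^ (k + Suc j)"
      using m(2)[of p] \<rho> by (intro mult_right_mono) auto
    also have "\<dots> = real (adm_count c 0 p) * \<rho> ^ (n + ?L)" by (simp only: p(2) power_add mult.assoc)
    also have "real (adm_count c 0 p) \<le> real (head_gap_total c g j (n + (?L - Suc j)))"
      using head_gap_total_lower_bound[OF coeffs_pos b, of p] by (simp add: p(1) k_def)
    also have "\<dots> \<le> f n" unfolding f_def
      using j by (intro member_le_sum[of j _ "\<lambda>i. real (head_gap_total c g i (n + (?L - Suc i)))"]) auto
    finally show ?thesis using \<rho> by (simp add: e_def mult_right_mono)
  qed
  then have "m * \<rho> ^ (k + Suc j) \<le> \<rho> ^ ?L * l"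
    using LIMSEQ_le_const[OF geom_conv_tendsto[OF e]] by blast
  moreover have "0 < m * \<rho> ^ (k + Suc j)" using m \<rho> by simp
  ultimately have \<eta>: "0 < \<rho> ^ ?L * l" by linarith
  show ?thesis
  proof (rule renewal_linear_growth[OF _ weight_pos sum_weight e \<eta>])
    fix n
    show "real (gap_total c g 0 (n + ?L)) * \<rho> ^ (n + ?L) =
        (\<Sum>i<?L. weight i * (real (gap_total c g 0 (n + i)) * \<rho> ^ (n + i))) + e n"
      unfolding e_def f_def
      by (rule scaled_renewal[of "gap_total c g" "head_gap_total c g", OF gap_total_Suc])
        (simp_all add: gap_total_def adm_lists_beyond)
  qed
qed

lemma difference_quotient_asymptotics:
  assumes a: "admissible c 0 a" "gap_count g a > 0"
  shows "\<exists>C d \<gamma>. 0 < C \<and> 0 < \<gamma> \<and> \<gamma> < 1 \<and>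
    (\<lambda>n. (real (gap_total c g 0 (Suc n)) - real (gap_total c g 0 n)) /
         (real (adm_count c 0 (Suc n)) - real (adm_count c 0 n)) - (C * real n + d)) \<in> O(\<lambda>n. \<gamma> ^ n)"
proof -
  define s where "s n = real (gap_total c g 0 n) * \<rho> ^ n" for n
  define w where "w n = real (adm_count c 0 n) * \<rho> ^ n" for n
  obtain C d where C: "0 < C" "geom_conv (\<lambda>n. s n - C * real n) d"
    using scaled_gap_total_conv[OF a] by (auto simp: s_def)
  obtain \<alpha> where \<alpha>: "0 < \<alpha>" "geom_conv w \<alpha>"
    using scaled_adm_count_conv by (auto simp: w_def[abs_def])
  \<comment> \<open>Scaling by \<open>\<rho> ^ Suc n\<close> turns a difference of consecutive
    totals into \<open>s (Suc n) - \<rho> * s n\<close>. The summand \<open>C\<close> compensates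
    for \<open>C * (n + 1)\<close> in place of \<open>C * n\<close>, which leaves the slope
    \<open>C * (1 - \<rho>)\<close>, positive as \<open>\<rho> < 1\<close>.\<close>
  have "geom_conv (\<lambda>n. s (n + 1) - C * real (n + 1) - \<rho> * (s n - C * real n) + C) (d - \<rho> * d + C)"
    by (intro geom_conv_add geom_conv_diff geom_conv_cmult geom_conv_const C
        geom_conv_shift[of "\<lambda>n. s n - C * real n"])
  then have x: "geom_conv (\<lambda>n. (s (Suc n) - \<rho> * s n) - C * (1 - \<rho>) * real n) (d - \<rho> * d + C)"
    by (simp add: algebra_simps)
  have "geom_conv (\<lambda>n. w (n + 1) - \<rho> * w n) (\<alpha> - \<rho> * \<alpha>)"
    by (intro geom_conv_diff geom_conv_cmult geom_conv_shift \<alpha>)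
  then have z: "geom_conv (\<lambda>n. w (Suc n) - \<rho> * w n) (\<alpha> * (1 - \<rho>))"
    by (simp add: algebra_simps)
  have "(s (Suc n) - \<rho> * s n) / (w (Suc n) - \<rho> * w n) =
      (real (gap_total c g 0 (Suc n)) - real (gap_total c g 0 n)) /
      (real (adm_count c 0 (Suc n)) - real (adm_count c 0 n))" for n
  proof -
    have "s (Suc n) - \<rho> * s n = (real (gap_total c g 0 (Suc n)) - real (gap_total c g 0 n)) * \<rho> ^ Suc n"
      "w (Suc n) - \<rho> * w n = (real (adm_count c 0 (Suc n)) - real (adm_count c 0 n)) * \<rho> ^ Suc n"
      by (simp_all add: s_def w_def algebra_simps)
    then show ?thesis using \<rho> by (simp only:) simp
  qed
  then show ?thesis using geom_conv_quotient[OF x z] C \<alpha> \<rho> by simp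
qed

end

section \<open>Existence of the growth rate and passage from words to integers\<close>

lemma growth_rate_exists:
  assumes "\<forall>x\<in>set c. x > 0" "c \<noteq> []" "c \<noteq> [1]"
  shows "\<exists>\<rho>. growth_rate c \<rho>"
proof -
  define f where "f x = (\<Sum>i<length c. real (c ! i) * x ^ Suc i)" for x :: real
  \<comment> \<open>Positive integers add up to 1 only for \<open>c = [1]\<close>. Hence
    \<open>f\<close> passes from 0 at 0 to above 1 at 1, and the intermediate value theorem gives
    \<open>\<rho>\<close> strictly between.\<close>
  have "1 < (\<Sum>i<length c. c ! i)"
  proof (cases "length c = 1")
    case True
    then obtain k where "c = [k]" by (auto simp: length_Suc_conv)
    with assms show ?thesis by auto
  next
    case False
    then have "1 < length c" using assms(2) by (cases "length c") auto
    also have "\<dots> = (\<Sum>i<length c. 1)" by simp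
    also have "\<dots> \<le> (\<Sum>i<length c. c ! i)"
      using assms(1) by (intro sum_mono) (auto simp: Suc_le_eq)
    finally show ?thesis .
  qed
  then have "1 < real (\<Sum>i<length c. c ! i)" by linarith
  then have f1: "1 < f 1" by (simp add: f_def)
  have f0: "f 0 = 0" by (simp add: f_def)
  have "continuous_on {0..1} f" unfolding f_def by (intro continuous_intros)
  then obtain \<rho> where \<rho>: "0 \<le> \<rho>" "\<rho> \<le> 1" "f \<rho> = 1"
    using IVT'[of f 0 1 1] f0 f1 by auto
  then have "\<rho> \<noteq> 0" "\<rho> \<noteq> 1" using f0 f1 by auto
  with \<rho> show ?thesis using assms by (intro exI[of _ \<rho>]) (unfold_locales, auto simp: f_def)
qed

text \<open>Words of length \<open>n + 1\<close> with positive leading digit are the legal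
  decompositions of the integers in the interval. The others are a 0 followed by a word of length
  \<open>n\<close>, and that 0 does not change the gaps.\<close>

lemma sum_num_gaps:
  fixes f :: "nat \<Rightarrow> 'b::comm_monoid_add"
  assumes G: "plrs c G"
  shows "(\<Sum>M\<in>{G (Suc n)..<G (Suc (Suc n))}. f (num_gaps c G g M)) + (\<Sum>a\<in>adm_lists c 0 n. f (gap_count g a))
    = (\<Sum>a\<in>adm_lists c 0 (Suc n). f (gap_count g a))"
proof -
  have c: "c \<noteq> []" using G by (auto simp: plrs_def)
  moreover have "c ! 0 > 0" using G c by (auto simp: plrs_def hd_conv_nth)
  ultimately have c: "c \<noteq> []" "c ! 0 > 0" by blast+
  note GV = plrs_eq_adm_count[OF G]
  define A where "A = {a \<in> adm_lists c 0 (Suc n). hd a > 0}"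
  have split: "adm_lists c 0 (Suc n) = A \<union> (#) 0 ` adm_lists c 0 n"
  proof (intro set_eqI)
    fix a show "a \<in> adm_lists c 0 (Suc n) \<longleftrightarrow> a \<in> A \<union> (#) 0 ` adm_lists c 0 n"
      using c by (cases a) (auto simp: A_def adm_lists_def)
  qed
  have disj: "A \<inter> (#) 0 ` adm_lists c 0 n = {}" by (auto simp: A_def)
  have legalA: "legal c a \<and> length a = Suc n" if "a \<in> A" for a
  proof -
    have "admissible c 0 a" "length a = Suc n" "hd a > 0" using that by (simp_all add: A_def adm_lists_def)
    moreover from this have "a \<noteq> []" by fastforce
    ultimately show ?thesis using legal_iff_admissible[OF c] by blast
  qed
  have "bij_betw (decomp_value G) A {G (Suc n)..<G (Suc (Suc n))}"
    unfolding bij_betw_def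
  proof (intro conjI equalityI subsetI)
    note bij = bij_betw_decomp_value[of G c 0, OF GV]
    show "inj_on (decomp_value G) A"
      using bij[of "Suc n"] by (auto simp: bij_betw_def A_def intro: inj_on_subset)
    show "M \<in> {G (Suc n)..<G (Suc (Suc n))}" if "M \<in> decomp_value G ` A" for M
      using that legalA legal_decomp_eq(2)[OF G] by fastforce
    show "M \<in> decomp_value G ` A" if M: "M \<in> {G (Suc n)..<G (Suc (Suc n))}" for M
    proof -
      obtain a where a: "a \<in> adm_lists c 0 (Suc n)" "M = decomp_value G a"
        using bij[of "Suc n"] M GV by (auto simp: bij_betw_def image_iff set_eq_iff)
      have "a \<notin> (#) 0 ` adm_lists c 0 n"
      proof
        assume "a \<in> (#) 0 ` adm_lists c 0 n"
        then obtain b where "a = 0 # b" "b \<in> adm_lists c 0 n" by blast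
        then have "M < G (Suc n)" using bij[of n] a(2) GV by (auto simp: bij_betw_def decomp_value_Cons)
        with M show False by simp
      qed
      with a split show ?thesis by blast
    qed
  qed
  then have "(\<Sum>M\<in>{G (Suc n)..<G (Suc (Suc n))}. f (num_gaps c G g M)) = (\<Sum>a\<in>A. f (num_gaps c G g (decomp_value G a)))"
    by (rule sum.reindex_bij_betw[symmetric])
  also have "\<dots> = (\<Sum>a\<in>A. f (gap_count g a))"
    using legalA by (intro sum.cong refl) (simp add: num_gaps_def legal_decomp_eq(1)[OF G] gap_count_eq)
  finally show ?thesis unfolding split
    by (subst sum.union_disjoint)
      (use disj in \<open>simp_all add: A_def sum.reindex head_gaps_def\<close>)
qed

lemma mean_gaps_eq:
  assumes G: "plrs c G" and nonempty: "G (Suc n) < G (Suc (Suc n))"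
  shows "mean_gaps c G g (Suc n) =
    (real (gap_total c g 0 (Suc n)) - real (gap_total c g 0 n)) /
    (real (adm_count c 0 (Suc n)) - real (adm_count c 0 n))"
proof -
  have "mean_gaps c G g (Suc n) =
      (\<Sum>M\<in>{G (Suc n)..<G (Suc (Suc n))}. real (num_gaps c G g M)) / real (card {G (Suc n)..<G (Suc (Suc n))})"
    using nonempty by (simp add: mean_gaps_def integral_pmf_of_set)
  also have "(\<Sum>M\<in>{G (Suc n)..<G (Suc (Suc n))}. real (num_gaps c G g M)) =
      real (gap_total c g 0 (Suc n)) - real (gap_total c g 0 n)"
    using sum_num_gaps[OF G, of real g n] by (simp add: gap_total_def)
  also have "real (card {G (Suc n)..<G (Suc (Suc n))}) = real (adm_count c 0 (Suc n)) - real (adm_count c 0 n)"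
    using nonempty by (simp add: plrs_eq_adm_count[OF G] of_nat_diff)
  finally show ?thesis .
qed

lemma plrs_strict_increase:
  assumes G: "plrs c G" and c: "\<forall>x\<in>set c. x > 0" "c \<noteq> [1]"
  shows "G (Suc n) < G (Suc (Suc n))"
proof -
  have c': "c \<noteq> []" using G by (auto simp: plrs_def)
  obtain \<rho> where "growth_rate c \<rho>" using growth_rate_exists[OF c(1) c' c(2)] by blast
  then interpret growth_rate c \<rho> .
  have "adm_count c 0 n < adm_count c 0 (Suc n)"
  proof (cases "c ! 0 = 1")
    case True
    then have L: "1 < length c" using c' c(2) by (cases c; cases "tl c") auto
    \<comment> \<open>If the first coefficient is 1 there is a second one, and its positivity lets
      zeros follow the digit 1; such words are the strict surplus over the words starting with
      0.\<close>
    have "admissible c 1 (replicate n 0)"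
      using L c c' by (cases n) (auto simp: admissible_zeros[of c _ "[]", simplified])
    then have "adm_lists c 1 n \<noteq> {}" by (auto simp: adm_lists_def intro: exI[of _ "replicate n 0"])
    then have "0 < adm_count c 1 n" by (simp add: adm_count_def card_gt_0_iff)
    then show ?thesis using c' by (simp add: adm_count_Suc True)
  next
    case False
    then have "2 \<le> c ! 0" using c c' by (cases c) auto
    then have "2 * adm_count c 0 n \<le> c ! 0 * adm_count c 0 n" by (rule mult_right_mono) simp
    then have "adm_count c 0 n < c ! 0 * adm_count c 0 n" using adm_count_pos[of n] by linarith
    moreover have "adm_count c 0 (Suc n) = c ! 0 * adm_count c 0 n + adm_count c 1 n"
      using c' by (simp add: adm_count_Suc)
    ultimately show ?thesis by linarith
  qed
  then show ?thesis by (simp add: plrs_eq_adm_count[OF G])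
qed

lemma nontrivial_gaps_imp_list:
  assumes G: "plrs c G" and nt: "nontrivial_gaps c G g (Suc n)"
  shows "\<exists>a. admissible c 0 a \<and> gap_count g a > 0"
proof (rule ccontr)
  assume "\<not> ?thesis"
  then have zero: "(\<Sum>a\<in>adm_lists c 0 (Suc n). gap_count g a) = 0" by (auto simp: adm_lists_def)
  obtain M where "M \<in> {G (Suc n)..<G (Suc (Suc n))}" "num_gaps c G g M \<noteq> 0"
    using nt by (auto simp: nontrivial_gaps_def)
  then have "0 < (\<Sum>M\<in>{G (Suc n)..<G (Suc (Suc n))}. num_gaps c G g M)"
    by (intro sum_pos2[of _ M]) auto
  with zero sum_num_gaps[OF G, of "\<lambda>x. x" g n] show False by simp
qed

lemma bigo_geometric_unshift:
  fixes f :: "nat \<Rightarrow> real"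
  assumes "(\<lambda>n. f (Suc n)) \<in> O(\<lambda>n. \<gamma> ^ n)" "0 < \<gamma>"
  shows "f \<in> O(\<lambda>n. \<gamma> ^ n)"
proof -
  obtain K where K: "\<forall>\<^sub>F n in sequentially. norm (f (Suc n)) \<le> K * norm (\<gamma> ^ n)"
    using landau_o.bigE[OF assms(1)] by blast
  then have "\<forall>\<^sub>F n in sequentially. norm (f (Suc n)) \<le> K / \<gamma> * norm (\<gamma> ^ Suc n)"
    using assms(2) by simp
  then show ?thesis
    by (intro bigoI[of _ "K / \<gamma>"]) (subst (asm) eventually_sequentially_Suc, simp)
qed

theorem theorem1p6:
  fixes g :: nat and c :: "nat list"
  assumes coeffs_pos: "\<forall>x\<in>set c. x > 0"
  shows "\<exists>(C::real) (d::real) (\<gamma>::real). C > 0 \<and> 0 < \<gamma> \<and> \<gamma> < 1 \<and>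
    (\<forall>G. plrs c G \<longrightarrow> (\<exists>n0. \<forall>n\<ge>n0. nontrivial_gaps c G g n) \<longrightarrow>
      (\<lambda>n. mean_gaps c G g n - (C * real n + d)) \<in> O(\<lambda>n. \<gamma> ^ n))"
proof (cases "\<exists>G. plrs c G \<and> (\<exists>n0. \<forall>n\<ge>n0. nontrivial_gaps c G g n)")
  case False
  \<comment> \<open>No sequence satisfies the hypotheses, so arbitrary constants will do.\<close>
  then show ?thesis by (intro exI[of _ 1] exI[of _ 0] exI[of _ "1/2"]) auto
next
  case True
  then obtain G n where G: "plrs c G" and nt: "nontrivial_gaps c G g (Suc n)"
    using le_SucI by blast
  have c: "c \<noteq> []" using G by (auto simp: plrs_def)
  have c1: "c \<noteq> [1]"
  proof
    assume "c = [1]"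
    then have "G (Suc n) = G (Suc (Suc n))"
      by (simp add: plrs_eq_adm_count[OF G] adm_count_Suc adm_count_beyond)
    with nt show False by (simp add: nontrivial_gaps_def)
  qed
  obtain \<rho> where "growth_rate c \<rho>" using growth_rate_exists[OF coeffs_pos c c1] by blast
  then interpret growth_rate c \<rho> .
  obtain a where a: "admissible c 0 a" "gap_count g a > 0"
    using nontrivial_gaps_imp_list[OF G nt] by blast
  \<comment> \<open>The constants come from word counts, which depend on \<open>c\<close> and
    \<open>g\<close> alone; \<open>G\<close> served only to produce a word containing a gap.\<close>
  obtain C d \<gamma> where C: "0 < C" "0 < \<gamma>" "\<gamma> < 1"
    and asymp: "(\<lambda>n. (real (gap_total c g 0 (Suc n)) - real (gap_total c g 0 n)) /
         (real (adm_count c 0 (Suc n)) - real (adm_count c 0 n)) - (C * real n + d)) \<in> O(\<lambda>n. \<gamma> ^ n)"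
    using difference_quotient_asymptotics[OF a] by blast
  \<comment> \<open>The quotient at \<open>n\<close> is the mean at \<open>n + 1\<close>, so the
    constant term becomes \<open>d - C\<close>.\<close>
  have "(\<lambda>n. mean_gaps c H g n - (C * real n + (d - C))) \<in> O(\<lambda>n. \<gamma> ^ n)" if H: "plrs c H" for H
  proof (rule bigo_geometric_unshift[OF _ C(2)])
    have "mean_gaps c H g (Suc n) - (C * real (Suc n) + (d - C)) =
        (real (gap_total c g 0 (Suc n)) - real (gap_total c g 0 n)) /
         (real (adm_count c 0 (Suc n)) - real (adm_count c 0 n)) - (C * real n + d)" for n
      using mean_gaps_eq[OF H plrs_strict_increase[OF H coeffs_pos c1]] by (simp add: algebra_simps)
    then show "(\<lambda>n. mean_gaps c H g (Suc n) - (C * real (Suc n) + (d - C))) \<in> O(\<lambda>n. \<gamma> ^ n)"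
      using asymp by (simp only:)
  qed
  with C show ?thesis by blast
qed

end
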